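(* Let $\Omega\subseteq\mathbb{R}^p$ be open and $f\in\mathcal{G}(\Omega)$. If $x_0\in\Omega$ is a local minimum of $f$, then (i) $Df(x_0)=0$ in $\tilde{\mathbb{R}}^p$; (ii) the Hessian $D^2f(x_0)\in\tilde{\mathbb{R}}^{p^2}$ is positive semidefinite.
   Context: $\mathcal{G}(\Omega)=\mathcal{E}_M(\Omega)/\mathcal{N}(\Omega)$ is the (special) Colombeau algebra: $\mathcal{E}_M(\Omega)$ is the set of nets $(u_\varepsilon)_{\varepsilon\in(0,1]}$ in $C^\infty(\Omega)$ such that for every compact $K\subset\Omega$ and every multi-index $\alpha$ there is $N\in\mathbb{N}$ with $\sup_K|\partial^\alpha u_\varepsilon|=O(\varepsilon^{-N})$ as $\varepsilon\to0$; $\mathcal{N}(\Omega)$ is the set of nets such that for all such $K,\alpha$ and all $m\in\mathbb{N}$, $\sup_K|\partial^\alpha u_\varepsilon|=O(\varepsilon^m)$. Derivatives are componentwise. $\tilde{\mathbb{R}}$ is the ring of nets of reals with $|x_\varepsilon|=O(\varepsilon^{-N})$ for some $N$, modulo nets with $|x_\varepsilon|=O(\varepsilon^m)$ for all $m$. $\tilde x\ge0$ in $\tilde{\mathbb{R}}$ means that $\tilde x$ has a representative with all $x_\varepsilon\ge0$; $\tilde x\le\tilde y$ means $\tilde y-\tilde x\ge0$. $\tilde\Omega_c$ denotes the set of compactly supported generalized points of $\Omega$: equivalence classes of nets $(x_\varepsilon)_\varepsilon$ in $\Omega$ which lie in a fixed compact subset of $\Omega$ for all sufficiently small $\varepsilon$,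 two nets being equivalent if $|x_\varepsilon-y_\varepsilon|=O(\varepsilon^m)$ for all $m$. Points of $\Omega$ are identified with constant nets. For $f=[(f_\varepsilon)_\varepsilon]\in\mathcal{G}(\Omega)$ and $\tilde x=[(x_\varepsilon)_\varepsilon]\in\tilde\Omega_c$ the value $f(\tilde x)=[(f_\varepsilon(x_\varepsilon))_\varepsilon]\in\tilde{\mathbb{R}}$ is well-defined. A point $x_0\in\Omega$ is a local minimum of $f$ if there is a neighborhood $\Omega'\subseteq\Omega$ of $x_0$ with $f(x_0)\le f(\tilde x)$ for all $\tilde x\in\tilde\Omega'_c$. A symmetric matrix $A\in\tilde{\mathbb{R}}^{p^2}$ is positive semidefinite if $\tilde\xi^{T}A\tilde\xi\ge0$ in $\tilde{\mathbb{R}}$ for all $\tilde\xi\in\tilde{\mathbb{R}}^p$. *)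

theory Defs
  imports "HOL-Analysis.Analysis" "HOL-Library.Landau_Symbols"
begin

text \<open>
  Nets indexed by \<open>\<epsilon> \<in> (0,1]\<close> are functions on \<open>real\<close> whose values outside \<open>{0<..1}\<close> are
  never inspected; \<open>\<epsilon> \<rightarrow> 0\<close> is the filter \<open>at_right 0\<close>.
\<close>

section \<open>The ring of generalized real numbers\<close>

definition moderate_net :: "(real \<Rightarrow> real) \<Rightarrow> bool" where
  "moderate_net x \<longleftrightarrow> (\<exists>N::nat. x \<in> O[at_right 0](\<lambda>\<epsilon>. 1 / \<epsilon> ^ N))"

definition negligible_net :: "(real \<Rightarrow> real) \<Rightarrow> bool" where
  "negligible_net x \<longleftrightarrow> (\<forall>m::nat. x \<in> O[at_right 0](\<lambda>\<epsilon>. \<epsilon> ^ m))"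

definition net_eq :: "(real \<Rightarrow> real) \<Rightarrow> (real \<Rightarrow> real) \<Rightarrow> bool" where
  "net_eq x y \<longleftrightarrow> moderate_net x \<and> moderate_net y \<and> negligible_net (\<lambda>\<epsilon>. x \<epsilon> - y \<epsilon>)"

lemma moderate_net_const: "moderate_net (\<lambda>_. c)"
  unfolding moderate_net_def by (rule exI[of _ 0]) simp

lemma moderate_net_add:
  assumes "moderate_net x" "moderate_net y"
  shows "moderate_net (\<lambda>\<epsilon>. x \<epsilon> + y \<epsilon>)"
proof -
  obtain M N where x: "x \<in> O[at_right 0](\<lambda>\<epsilon>. 1 / \<epsilon> ^ M)" and y: "y \<in> O[at_right 0](\<lambda>\<epsilon>. 1 / \<epsilon> ^ N)"
    using assms unfolding moderate_net_def by blast
  have *: "(\<lambda>\<epsilon>::real. 1 / \<epsilon> ^ k) \<in> O[at_right 0](\<lambda>\<epsilon>. 1 / \<epsilon> ^ (max M N))" if "k \<le> max M N" for k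
  proof (rule landau_o.bigI[of 1])
    show "\<forall>\<^sub>F \<epsilon> in at_right 0. norm (1 / \<epsilon> ^ k :: real) \<le> 1 * norm (1 / \<epsilon> ^ (max M N) :: real)"
      using eventually_at_right_real[of 0 1]
    proof (rule eventually_mono)
      fix \<epsilon> :: real assume "\<epsilon> \<in> {0<..<1}"
      then show "norm (1 / \<epsilon> ^ k) \<le> 1 * norm (1 / \<epsilon> ^ (max M N))"
        using that power_decreasing[of k "max M N" \<epsilon>] by (simp add: frac_le)
    qed simp
  qed simp
  have "x \<in> O[at_right 0](\<lambda>\<epsilon>. 1 / \<epsilon> ^ (max M N))" "y \<in> O[at_right 0](\<lambda>\<epsilon>. 1 / \<epsilon> ^ (max M N))"
    using landau_o.big_trans[OF x *] landau_o.big_trans[OF y *] by auto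
  then show ?thesis unfolding moderate_net_def by (blast intro: sum_in_bigo)
qed

lemma moderate_net_uminus: "moderate_net x \<Longrightarrow> moderate_net (\<lambda>\<epsilon>. - x \<epsilon>)"
  unfolding moderate_net_def by simp

lemma moderate_net_mult:
  assumes "moderate_net x" "moderate_net y"
  shows "moderate_net (\<lambda>\<epsilon>. x \<epsilon> * y \<epsilon>)"
proof -
  obtain M N where x: "x \<in> O[at_right 0](\<lambda>\<epsilon>. 1 / \<epsilon> ^ M)" and y: "y \<in> O[at_right 0](\<lambda>\<epsilon>. 1 / \<epsilon> ^ N)"
    using assms unfolding moderate_net_def by blast
  show ?thesis unfolding moderate_net_def
    using landau_o.big.mult[OF x y] by (intro exI[of _ "M + N"]) (simp add: power_add)
qed

lemma negligible_net_add:
  "negligible_net x \<Longrightarrow> negligible_net y \<Longrightarrow> negligible_net (\<lambda>\<epsilon>. x \<epsilon> + y \<epsilon>)"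
  unfolding negligible_net_def by (blast intro: sum_in_bigo)

lemma negligible_net_uminus: "negligible_net x \<Longrightarrow> negligible_net (\<lambda>\<epsilon>. - x \<epsilon>)"
  unfolding negligible_net_def by simp

lemma negligible_net_mult:
  assumes "negligible_net x" "moderate_net y"
  shows "negligible_net (\<lambda>\<epsilon>. x \<epsilon> * y \<epsilon>)"
  unfolding negligible_net_def
proof
  fix m :: nat
  obtain N where y: "y \<in> O[at_right 0](\<lambda>\<epsilon>. 1 / \<epsilon> ^ N)"
    using assms unfolding moderate_net_def by blast
  have x: "x \<in> O[at_right 0](\<lambda>\<epsilon>. \<epsilon> ^ (m + N))"
    using assms unfolding negligible_net_def by blast
  have "(\<lambda>\<epsilon>. x \<epsilon> * y \<epsilon>) \<in> O[at_right 0](\<lambda>\<epsilon>. \<epsilon> ^ (m + N) * (1 / \<epsilon> ^ N))"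
    by (rule landau_o.big.mult[OF x y])
  also have "(\<lambda>\<epsilon>::real. \<epsilon> ^ (m + N) * (1 / \<epsilon> ^ N)) \<in> O[at_right 0](\<lambda>\<epsilon>. \<epsilon> ^ m)"
    by (intro bigoI[of _ 1] eventually_mono[OF eventually_at_right_less[of "0::real"]])
       (simp add: power_add)
  finally show "(\<lambda>\<epsilon>. x \<epsilon> * y \<epsilon>) \<in> O[at_right 0](\<lambda>\<epsilon>. \<epsilon> ^ m)" .
qed

lemma part_equivp_net_eq: "part_equivp net_eq"
proof (rule part_equivpI)
  show "\<exists>x. net_eq x x"
    by (rule exI[of _ "\<lambda>_. 0"]) (simp add: net_eq_def moderate_net_const negligible_net_def)
  show "symp net_eq"
    by (rule sympI) (auto simp: net_eq_def dest: negligible_net_uminus)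
  show "transp net_eq"
    by (rule transpI) (auto simp: net_eq_def dest: negligible_net_add)
qed

quotient_type gen_real = "real \<Rightarrow> real" / partial: net_eq
  by (rule part_equivp_net_eq)

lemma net_eq_self_iff: "net_eq x x \<longleftrightarrow> moderate_net x"
  by (simp add: net_eq_def negligible_net_def)

lemma not_net_eq_0_1: "\<not> net_eq (\<lambda>_. 0) (\<lambda>_. 1)"
proof
  assume "net_eq (\<lambda>_. 0) (\<lambda>_. 1)"
  then have "(\<lambda>_. - 1::real) \<in> O[at_right 0](\<lambda>\<epsilon>::real. \<epsilon> ^ 1)"
    unfolding net_eq_def negligible_net_def by (metis diff_0)
  then obtain c where c: "c > 0" "\<forall>\<^sub>F \<epsilon> in at_right 0. norm (- 1::real) \<le> c * norm (\<epsilon> ^ 1 :: real)"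
    by (rule landau_o.bigE)
  have "\<forall>\<^sub>F \<epsilon> in at_right (0::real). \<epsilon> \<in> {0<..<1/c}"
    using c by (intro eventually_at_right_real) simp
  then have "\<forall>\<^sub>F \<epsilon> in at_right (0::real). False"
    using c(2) by eventually_elim (use c(1) in \<open>auto simp: field_simps\<close>)
  then show False by simp
qed

instantiation gen_real :: comm_ring_1
begin

lift_definition zero_gen_real :: gen_real is "\<lambda>_. 0"
  by (simp add: net_eq_def moderate_net_const negligible_net_def)

lift_definition one_gen_real :: gen_real is "\<lambda>_. 1"
  by (simp add: net_eq_def moderate_net_const negligible_net_def)

lift_definition plus_gen_real :: "gen_real \<Rightarrow> gen_real \<Rightarrow> gen_real" is "\<lambda>x y \<epsilon>. x \<epsilon> + y \<epsilon>"
  unfolding net_eq_def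
  using negligible_net_add by (fastforce simp: moderate_net_add algebra_simps)

lift_definition uminus_gen_real :: "gen_real \<Rightarrow> gen_real" is "\<lambda>x \<epsilon>. - x \<epsilon>"
  unfolding net_eq_def
  by (auto simp: moderate_net_uminus dest: negligible_net_uminus)

lift_definition times_gen_real :: "gen_real \<Rightarrow> gen_real \<Rightarrow> gen_real" is "\<lambda>x y \<epsilon>. x \<epsilon> * y \<epsilon>"
proof -
  fix x x' y y' assume a: "net_eq x x'" "net_eq y y'"
  have "negligible_net (\<lambda>\<epsilon>. (x \<epsilon> - x' \<epsilon>) * y \<epsilon> + (y \<epsilon> - y' \<epsilon>) * x' \<epsilon>)"
    using a unfolding net_eq_def by (intro negligible_net_add negligible_net_mult) auto
  moreover have "(\<lambda>\<epsilon>. (x \<epsilon> - x' \<epsilon>) * y \<epsilon> + (y \<epsilon> - y' \<epsilon>) * x' \<epsilon>) = (\<lambda>\<epsilon>. x \<epsilon> * y \<epsilon> - x' \<epsilon> * y' \<epsilon>)"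
    by (auto simp: algebra_simps)
  ultimately show "net_eq (\<lambda>\<epsilon>. x \<epsilon> * y \<epsilon>) (\<lambda>\<epsilon>. x' \<epsilon> * y' \<epsilon>)"
    using a by (simp add: net_eq_def moderate_net_mult)
qed

definition minus_gen_real :: "gen_real \<Rightarrow> gen_real \<Rightarrow> gen_real" where
  "minus_gen_real x y = x + - y"

instance
proof
  fix a b c :: gen_real
  show "a * b * c = a * (b * c)"
    by transfer (simp add: mult.assoc net_eq_self_iff moderate_net_mult)
  show "a * b = b * a"
    by transfer (simp add: mult.commute net_eq_self_iff moderate_net_mult)
  show "1 * a = a" by transfer simp
  show "a + b + c = a + (b + c)"
    by transfer (simp add: add.assoc net_eq_self_iff moderate_net_add)
  show "a + b = b + a"
    by transfer (simp add: add.commute net_eq_self_iff moderate_net_add)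
  show "0 + a = a" by transfer simp
  show "- a + a = 0" by transfer (simp add: net_eq_self_iff moderate_net_const)
  show "a - b = a + - b" by (simp add: minus_gen_real_def)
  show "(a + b) * c = a * c + b * c"
    by transfer (simp add: distrib_right net_eq_self_iff moderate_net_add moderate_net_mult)
  show "(0::gen_real) \<noteq> 1" by transfer (rule not_net_eq_0_1)
qed

end

definition gen_nonneg :: "gen_real \<Rightarrow> bool" where
  "gen_nonneg X \<longleftrightarrow> (\<exists>x. moderate_net x \<and> X = abs_gen_real x \<and> (\<forall>\<epsilon>\<in>{0<..1}. 0 \<le> x \<epsilon>))"

lemma abs_gen_real_eq_iff:
  "moderate_net x \<Longrightarrow> moderate_net y \<Longrightarrow>
    abs_gen_real x = abs_gen_real y \<longleftrightarrow> negligible_net (\<lambda>\<epsilon>. x \<epsilon> - y \<epsilon>)"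
  using Quotient3_rel[OF Quotient3_gen_real, of x y] by (simp add: net_eq_self_iff) (simp add: net_eq_def)

lemma abs_gen_real_plus:
  "moderate_net x \<Longrightarrow> moderate_net y \<Longrightarrow>
    abs_gen_real x + abs_gen_real y = abs_gen_real (\<lambda>\<epsilon>. x \<epsilon> + y \<epsilon>)"
  by (simp add: plus_gen_real.abs_eq net_eq_self_iff)

lemma abs_gen_real_times:
  "moderate_net x \<Longrightarrow> moderate_net y \<Longrightarrow>
    abs_gen_real x * abs_gen_real y = abs_gen_real (\<lambda>\<epsilon>. x \<epsilon> * y \<epsilon>)"
  by (simp add: times_gen_real.abs_eq net_eq_self_iff)

lemma gen_nonneg_add: "gen_nonneg X \<Longrightarrow> gen_nonneg Y \<Longrightarrow> gen_nonneg (X + Y)"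
  unfolding gen_nonneg_def
  by (elim exE conjE, hypsubst, intro exI conjI)
     (rule moderate_net_add, assumption, assumption, rule abs_gen_real_plus, assumption+, simp)

lemma gen_nonneg_mult: "gen_nonneg X \<Longrightarrow> gen_nonneg Y \<Longrightarrow> gen_nonneg (X * Y)"
  unfolding gen_nonneg_def
  by (elim exE conjE, hypsubst, intro exI conjI)
     (rule moderate_net_mult, assumption, assumption, rule abs_gen_real_times, assumption+, simp)

lemma gen_nonneg_0: "gen_nonneg 0"
  unfolding gen_nonneg_def zero_gen_real_def
  by (auto intro!: exI[of _ "\<lambda>_. 0"] moderate_net_const)

lemma gen_nonneg_antisym:
  assumes "gen_nonneg X" "gen_nonneg (- X)" shows "X = 0"
proof -
  obtain x y where x: "moderate_net x" "X = abs_gen_real x" "\<And>\<epsilon>. \<epsilon> \<in> {0<..1} \<Longrightarrow> 0 \<le> x \<epsilon>"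
    and y: "moderate_net y" "- X = abs_gen_real y" "\<And>\<epsilon>. \<epsilon> \<in> {0<..1} \<Longrightarrow> 0 \<le> y \<epsilon>"
    using assms unfolding gen_nonneg_def by blast
  have "abs_gen_real (\<lambda>\<epsilon>. x \<epsilon> + y \<epsilon>) = abs_gen_real (\<lambda>_. 0)"
    using x y by (metis abs_gen_real_plus add.right_inverse zero_gen_real_def)
  then have *: "negligible_net (\<lambda>\<epsilon>. x \<epsilon> + y \<epsilon>)"
    using x y by (simp add: abs_gen_real_eq_iff moderate_net_add moderate_net_const)
  have "\<forall>\<^sub>F \<epsilon> in at_right (0::real). \<epsilon> \<in> {0<..<1}"
    by (intro eventually_at_right_real) simp
  then have "x \<in> O[at_right 0](\<lambda>\<epsilon>. x \<epsilon> + y \<epsilon>)"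
    by (intro bigoI[of _ 1]) (auto elim!: eventually_mono intro!: abs_leI simp: x(3) y(3))
  then have "negligible_net x"
    using * unfolding negligible_net_def by (blast intro: landau_o.big_trans)
  then show ?thesis
    using x by (simp add: zero_gen_real_def abs_gen_real_eq_iff moderate_net_const)
qed

instantiation gen_real :: ordered_comm_ring
begin

definition less_eq_gen_real :: "gen_real \<Rightarrow> gen_real \<Rightarrow> bool" where
  "X \<le> Y \<longleftrightarrow> gen_nonneg (Y - X)"

definition less_gen_real :: "gen_real \<Rightarrow> gen_real \<Rightarrow> bool" where
  "X < Y \<longleftrightarrow> X \<le> Y \<and> X \<noteq> (Y :: gen_real)"

instance
proof
  fix a b c :: gen_real
  show "a \<le> a" by (simp add: less_eq_gen_real_def gen_nonneg_0)
  show "a \<le> c" if "a \<le> b" "b \<le> c"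
    using gen_nonneg_add[of "c - b" "b - a"] that by (simp add: less_eq_gen_real_def)
  show anti: "a = b" if "a \<le> b" "b \<le> a" for a b :: gen_real
    using gen_nonneg_antisym[of "b - a"] that by (simp add: less_eq_gen_real_def)
  show "a < b \<longleftrightarrow> a \<le> b \<and> \<not> b \<le> a"
    using anti \<open>a \<le> a\<close> by (auto simp: less_gen_real_def)
  show "c + a \<le> c + b" if "a \<le> b"
    using that by (simp add: less_eq_gen_real_def)
  show "c * a \<le> c * b" if "a \<le> b" "0 \<le> c"
    using gen_nonneg_mult[of c "b - a"] that
    by (simp add: less_eq_gen_real_def right_diff_distrib)
qed

end


section \<open>Smooth functions and the Colombeau algebra\<close>

definition partial_deriv :: "'n \<Rightarrow> (real^'n \<Rightarrow> real) \<Rightarrow> real^'n \<Rightarrow> real" where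
  "partial_deriv i g x = deriv (\<lambda>t. g (x + t *\<^sub>R axis i 1)) 0"

text \<open>
  A multi-index is given as the list of the coordinate directions in which one differentiates;
  for smooth functions only the multiplicities of the coordinates in the list matter.
\<close>

definition multi_deriv :: "'n list \<Rightarrow> (real^'n \<Rightarrow> real) \<Rightarrow> real^'n \<Rightarrow> real" where
  "multi_deriv \<alpha> g = foldr partial_deriv \<alpha> g"

text \<open>
  For open \<open>\<Omega>\<close>, total differentiability of every iterated partial derivative amounts to existence
  and continuity of all of them.
\<close>

definition smooth_on :: "(real^'n) set \<Rightarrow> (real^'n \<Rightarrow> real) \<Rightarrow> bool" where
  "smooth_on \<Omega> g \<longleftrightarrow> (\<forall>\<alpha>. \<forall>x\<in>\<Omega>. multi_deriv \<alpha> g differentiable (at x))"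

text \<open>
  The compact set \<open>K\<close> is required to be nonempty because the real supremum of the empty set
  is not \<open>0\<close> in general.
\<close>

definition moderate_fun_nets :: "(real^'n) set \<Rightarrow> (real \<Rightarrow> real^'n \<Rightarrow> real) set" where
  "moderate_fun_nets \<Omega> = {u. (\<forall>\<epsilon>\<in>{0<..1}. smooth_on \<Omega> (u \<epsilon>)) \<and>
     (\<forall>K \<alpha>. compact K \<and> K \<subseteq> \<Omega> \<and> K \<noteq> {} \<longrightarrow>
       (\<exists>N::nat. (\<lambda>\<epsilon>. SUP x\<in>K. \<bar>multi_deriv \<alpha> (u \<epsilon>) x\<bar>) \<in> O[at_right 0](\<lambda>\<epsilon>. 1 / \<epsilon> ^ N)))}"

definition negligible_fun_nets :: "(real^'n) set \<Rightarrow> (real \<Rightarrow> real^'n \<Rightarrow> real) set" where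
  "negligible_fun_nets \<Omega> = {u. (\<forall>\<epsilon>\<in>{0<..1}. smooth_on \<Omega> (u \<epsilon>)) \<and>
     (\<forall>K \<alpha>. compact K \<and> K \<subseteq> \<Omega> \<and> K \<noteq> {} \<longrightarrow>
       (\<forall>m::nat. (\<lambda>\<epsilon>. SUP x\<in>K. \<bar>multi_deriv \<alpha> (u \<epsilon>) x\<bar>) \<in> O[at_right 0](\<lambda>\<epsilon>. \<epsilon> ^ m)))}"

definition fun_net_rel ::
  "(real^'n) set \<Rightarrow> ((real \<Rightarrow> real^'n \<Rightarrow> real) \<times> (real \<Rightarrow> real^'n \<Rightarrow> real)) set" where
  "fun_net_rel \<Omega> = {(u, v). u \<in> moderate_fun_nets \<Omega> \<and> v \<in> moderate_fun_nets \<Omega> \<and>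
     (\<lambda>\<epsilon> x. u \<epsilon> x - v \<epsilon> x) \<in> negligible_fun_nets \<Omega>}"

type_synonym 'n gen_fun = "(real \<Rightarrow> real^'n \<Rightarrow> real) set"

definition colombeau :: "(real^'n) set \<Rightarrow> 'n gen_fun set" where
  "colombeau \<Omega> = moderate_fun_nets \<Omega> // fun_net_rel \<Omega>"

definition gen_partial :: "(real^'n) set \<Rightarrow> 'n \<Rightarrow> 'n gen_fun \<Rightarrow> 'n gen_fun" where
  "gen_partial \<Omega> i f = (\<Union>u\<in>f. fun_net_rel \<Omega> `` {\<lambda>\<epsilon>. partial_deriv i (u \<epsilon>)})"


section \<open>Compactly supported generalized points and point values\<close>

type_synonym 'n gen_point = "(real \<Rightarrow> real^'n) set"

definition compact_point_nets :: "(real^'n) set \<Rightarrow> (real \<Rightarrow> real^'n) set" where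
  "compact_point_nets \<Omega> = {x. (\<forall>\<epsilon>\<in>{0<..1}. x \<epsilon> \<in> \<Omega>) \<and>
     (\<exists>K. compact K \<and> K \<subseteq> \<Omega> \<and> (\<forall>\<^sub>F \<epsilon> in at_right 0. x \<epsilon> \<in> K))}"

definition point_net_rel :: "(real^'n) set \<Rightarrow> ((real \<Rightarrow> real^'n) \<times> (real \<Rightarrow> real^'n)) set" where
  "point_net_rel \<Omega> = {(x, y). x \<in> compact_point_nets \<Omega> \<and> y \<in> compact_point_nets \<Omega> \<and>
     negligible_net (\<lambda>\<epsilon>. norm (x \<epsilon> - y \<epsilon>))}"

definition gen_points_c :: "(real^'n) set \<Rightarrow> 'n gen_point set" where
  "gen_points_c \<Omega> = compact_point_nets \<Omega> // point_net_rel \<Omega>"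

definition const_point :: "(real^'n) set \<Rightarrow> real^'n \<Rightarrow> 'n gen_point" where
  "const_point \<Omega> x = point_net_rel \<Omega> `` {\<lambda>_. x}"

text \<open>
  The common value of all representatives. No ambient open set is mentioned, so the same
  expression evaluates \<open>f \<in> colombeau \<Omega>\<close> at points of \<open>gen_points_c \<Omega>'\<close> for any \<open>\<Omega>' \<subseteq> \<Omega>\<close>.
\<close>

definition point_value :: "'n gen_fun \<Rightarrow> 'n gen_point \<Rightarrow> gen_real" where
  "point_value f X = (THE c. \<forall>u\<in>f. \<forall>x\<in>X. c = abs_gen_real (\<lambda>\<epsilon>. u \<epsilon> (x \<epsilon>)))"

definition is_local_min :: "(real^'n) set \<Rightarrow> 'n gen_fun \<Rightarrow> real^'n \<Rightarrow> bool" where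
  "is_local_min \<Omega> f x0 \<longleftrightarrow> x0 \<in> \<Omega> \<and>
     (\<exists>\<Omega>'. open \<Omega>' \<and> x0 \<in> \<Omega>' \<and> \<Omega>' \<subseteq> \<Omega> \<and>
       (\<forall>X\<in>gen_points_c \<Omega>'. point_value f (const_point \<Omega> x0) \<le> point_value f X))"

definition gen_gradient :: "(real^'n) set \<Rightarrow> 'n gen_fun \<Rightarrow> real^'n \<Rightarrow> gen_real^'n" where
  "gen_gradient \<Omega> f x = (\<chi> i. point_value (gen_partial \<Omega> i f) (const_point \<Omega> x))"

definition gen_hessian :: "(real^'n) set \<Rightarrow> 'n gen_fun \<Rightarrow> real^'n \<Rightarrow> gen_real^'n^'n" where
  "gen_hessian \<Omega> f x =
     (\<chi> i j. point_value (gen_partial \<Omega> i (gen_partial \<Omega> j f)) (const_point \<Omega> x))"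

definition pos_semidef :: "gen_real^'n^'n \<Rightarrow> bool" where
  "pos_semidef A \<longleftrightarrow> transpose A = A \<and> (\<forall>\<xi>. 0 \<le> (\<Sum>i\<in>UNIV. \<xi> $ i * (A *v \<xi>) $ i))"

end

theory Submission imports Defs begin

text \<open>
  Choose a representative \<open>u\<close> of the generalized function. Minimality at \<open>x\<^sub>0\<close> says that for every
  net of displacements \<open>v \<epsilon>\<close> staying in a fixed small ball,
  \<open>u \<epsilon> (x\<^sub>0 + v \<epsilon>) - u \<epsilon> x\<^sub>0\<close> is bounded below by \<open>-C \<epsilon> ^ m\<close> for every \<open>m\<close>
  (\<open>local_min_net_bound\<close>). The displacement may depend on \<open>\<epsilon>\<close>, and this is what makes the
  classical argument quantitative: the steps are powers \<open>\<epsilon> ^ k\<close> with \<open>k\<close> so large that the Taylor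
  remainder, whose coefficient grows at most like \<open>\<epsilon> ^ -N\<close>, becomes as small as desired, while
  the lower bound is requested with an exponent \<open>m\<close> that is larger still, so that it survives the
  division by the step size.

  For the gradient (\<open>local_min_partial_negligible\<close>) one steps against the sign of the partial
  derivative \<open>d \<epsilon>\<close>. The first-order expansion bounds \<open>\<epsilon> ^ k * \<bar>d \<epsilon>\<bar>\<close> by
  \<open>\<epsilon> ^ (2 * k) * \<epsilon> ^ -N\<close> plus an arbitrarily high power of \<open>\<epsilon>\<close>, up to constants; after division
  by \<open>\<epsilon> ^ k\<close> this is \<open>O(\<epsilon> ^ (k - N))\<close>, and \<open>k\<close> is arbitrary.

  For the Hessian (\<open>local_min_hessian_bound\<close>) the displacement is \<open>\<epsilon> ^ k\<close> times a representative
  of the generalized vector \<open>\<xi>\<close>. In the second-order expansion the gradient term is negligible by the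
  first part and the remainder is of order \<open>\<epsilon> ^ (3 * k)\<close> up to a fixed negative power of \<open>\<epsilon>\<close>, so
  the quadratic form is at least \<open>-C \<epsilon> ^ m\<close> for every \<open>m\<close>. By \<open>zero_le_abs_gen_real_iff\<close> this
  is exactly nonnegativity of its class. Symmetry of the Hessian is Schwarz's theorem for each
  \<open>u \<epsilon>\<close> (\<open>partial_deriv_commute\<close>).

  To pass between classes and representatives one needs that partial derivatives and point values
  are independent of the chosen nets (\<open>gen_partial_class\<close>, \<open>point_value_class\<close>).
\<close>

section \<open>Partial derivatives and smooth functions\<close>

lemma partial_deriv_eq_derivative:
  assumes "(g has_derivative g') (at y)"
  shows "partial_deriv i g y = g' (axis i 1)"
proof -
  have lin: "linear g'"
    using assms has_derivative_linear by blast
  have "((\<lambda>t. y + t *\<^sub>R axis i 1) has_derivative (\<lambda>t. t *\<^sub>R axis i 1)) (at (0::real))"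
    by (auto intro!: derivative_eq_intros)
  moreover have "(g has_derivative g') (at (y + 0 *\<^sub>R axis i 1))"
    using assms by simp
  ultimately have "((\<lambda>t. g (y + t *\<^sub>R axis i 1)) has_derivative (\<lambda>t. g' (t *\<^sub>R axis i 1))) (at 0)"
    using has_derivative_compose by blast
  moreover have "(\<lambda>t. g' (t *\<^sub>R axis i 1)) = (*) (g' (axis i 1))"
    using linear_scale[OF lin] by (auto simp: mult.commute)
  ultimately have "((\<lambda>t. g (y + t *\<^sub>R axis i 1)) has_field_derivative g' (axis i 1)) (at 0)"
    by (simp add: has_field_derivative_def)
  then show ?thesis
    unfolding partial_deriv_def by (rule DERIV_imp_deriv)
qed

lemma has_derivative_partials:
  fixes g :: "real^'n \<Rightarrow> real"
  assumes "g differentiable (at y)"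
  shows "(g has_derivative (\<lambda>v. \<Sum>i\<in>UNIV. v $ i * partial_deriv i g y)) (at y)"
proof -
  obtain g' where g': "(g has_derivative g') (at y)"
    using assms by (auto simp: differentiable_def)
  have lin: "linear g'"
    using g' has_derivative_linear by blast
  have "g' v = (\<Sum>i\<in>UNIV. v $ i * partial_deriv i g y)" for v
  proof -
    have "g' v = g' (\<Sum>i\<in>UNIV. v $ i *\<^sub>R axis i 1)"
      using basis_expansion[of v] by (simp add: scalar_mult_eq_scaleR)
    also have "\<dots> = (\<Sum>i\<in>UNIV. v $ i * g' (axis i 1))"
      by (simp add: linear_sum[OF lin] linear_scale[OF lin])
    finally show ?thesis
      by (simp add: partial_deriv_eq_derivative[OF g'])
  qed
  then have "g' = (\<lambda>v. \<Sum>i\<in>UNIV. v $ i * partial_deriv i g y)"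
    by blast
  with g' show ?thesis by simp
qed

lemma DERIV_along_line:
  fixes g :: "real^'n \<Rightarrow> real"
  assumes "g differentiable (at (x + t *\<^sub>R v))"
  shows "((\<lambda>t. g (x + t *\<^sub>R v)) has_field_derivative
           (\<Sum>i\<in>UNIV. v $ i * partial_deriv i g (x + t *\<^sub>R v))) (at t)"
proof -
  have "((\<lambda>t. x + t *\<^sub>R v) has_derivative (\<lambda>t. t *\<^sub>R v)) (at t)"
    by (auto intro!: derivative_eq_intros)
  from has_derivative_compose[OF this has_derivative_partials[OF assms]]
  show ?thesis
    unfolding has_field_derivative_def
    by (rule has_derivative_eq_rhs) (auto simp: sum_distrib_left mult_ac fun_eq_iff)
qed

lemma partial_deriv_cong:
  fixes g h :: "real^'n \<Rightarrow> real"
  assumes "open \<Omega>" "x \<in> \<Omega>" "\<And>y. y \<in> \<Omega> \<Longrightarrow> g y = h y"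
  shows "partial_deriv i g x = partial_deriv i h x"
  unfolding partial_deriv_def
proof (rule deriv_cong_ev)
  have "((\<lambda>t. x + t *\<^sub>R axis i 1) \<longlongrightarrow> x + 0 *\<^sub>R axis i 1) (nhds (0::real))"
    by (intro tendsto_intros filterlim_ident)
  then have "\<forall>\<^sub>F t in nhds (0::real). x + t *\<^sub>R axis i 1 \<in> \<Omega>"
    using assms(1,2) by (intro topological_tendstoD) auto
  then show "\<forall>\<^sub>F t in nhds (0::real). g (x + t *\<^sub>R axis i 1) = h (x + t *\<^sub>R axis i 1)"
    by eventually_elim (rule assms(3))
qed simp

lemma multi_deriv_Nil [simp]: "multi_deriv [] g = g"
  and multi_deriv_Cons: "multi_deriv (i # \<alpha>) g = partial_deriv i (multi_deriv \<alpha> g)"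
  and multi_deriv_snoc: "multi_deriv (\<alpha> @ [i]) g = multi_deriv \<alpha> (partial_deriv i g)"
  by (simp_all add: multi_deriv_def)

lemma smooth_on_partial_deriv: "smooth_on \<Omega> g \<Longrightarrow> smooth_on \<Omega> (partial_deriv i g)"
  unfolding smooth_on_def by (metis multi_deriv_snoc)

lemma smooth_on_differentiable: "smooth_on \<Omega> g \<Longrightarrow> x \<in> \<Omega> \<Longrightarrow> g differentiable (at x)"
  unfolding smooth_on_def by (metis multi_deriv_Nil)

lemma smooth_on_multi_deriv_continuous:
  assumes "smooth_on \<Omega> g" "K \<subseteq> \<Omega>"
  shows "continuous_on K (multi_deriv \<alpha> g)"
  using assms unfolding smooth_on_def
  by (meson continuous_at_imp_continuous_on differentiable_imp_continuous_within subsetD)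

text \<open>
  Linearity holds on \<open>\<Omega>\<close> only, where the iterated derivatives are known to be differentiable; the
  induction step therefore rests on \<open>partial_deriv_cong\<close>, by which a partial derivative sees no more
  than the values on a neighbourhood.
\<close>

lemma multi_deriv_lincomb:
  fixes g h :: "real^'n \<Rightarrow> real"
  assumes "open \<Omega>" "smooth_on \<Omega> g" "smooth_on \<Omega> h" "x \<in> \<Omega>"
  shows "multi_deriv \<alpha> (\<lambda>y. a * g y + b * h y) x = a * multi_deriv \<alpha> g x + b * multi_deriv \<alpha> h x"
  using assms(4)
proof (induction \<alpha> arbitrary: x)
  case (Cons i \<alpha>)
  let ?G = "multi_deriv \<alpha> g" and ?H = "multi_deriv \<alpha> h"
  have d: "?G differentiable (at x)" "?H differentiable (at x)"
    using assms Cons.prems by (auto simp: smooth_on_def)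
  have "multi_deriv (i # \<alpha>) (\<lambda>y. a * g y + b * h y) x = partial_deriv i (\<lambda>y. a * ?G y + b * ?H y) x"
    unfolding multi_deriv_Cons using Cons by (intro partial_deriv_cong[OF assms(1)]) auto
  also have "\<dots> = a * partial_deriv i ?G x + b * partial_deriv i ?H x"
    by (subst partial_deriv_eq_derivative[where g = "\<lambda>y. a * ?G y + b * ?H y"],
        rule has_derivative_add[OF has_derivative_mult_right has_derivative_mult_right,
          OF d[THEN has_derivative_partials]])
       (simp add: axis_def if_distrib[of "\<lambda>z. z * _"] cong: if_cong)
  finally show ?case by (simp add: multi_deriv_Cons)
qed simp

lemma smooth_on_lincomb:
  fixes g h :: "real^'n \<Rightarrow> real"
  assumes "open \<Omega>" "smooth_on \<Omega> g" "smooth_on \<Omega> h"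
  shows "smooth_on \<Omega> (\<lambda>y. a * g y + b * h y)"
  unfolding smooth_on_def
proof (intro allI ballI)
  fix \<alpha> x assume x: "x \<in> \<Omega>"
  have "(\<lambda>y. a * multi_deriv \<alpha> g y + b * multi_deriv \<alpha> h y) differentiable (at x)"
    using assms x unfolding smooth_on_def by (intro derivative_intros) auto
  then obtain D where
    "((\<lambda>y. a * multi_deriv \<alpha> g y + b * multi_deriv \<alpha> h y) has_derivative D) (at x)"
    by (auto simp: differentiable_def)
  then have "(multi_deriv \<alpha> (\<lambda>y. a * g y + b * h y) has_derivative D) (at x)"
    by (rule has_derivative_transform_within_open[OF _ assms(1) x])
       (simp add: multi_deriv_lincomb[OF assms])
  then show "multi_deriv \<alpha> (\<lambda>y. a * g y + b * h y) differentiable (at x)"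
    by (auto simp: differentiable_def)
qed

lemma multi_deriv_zero: "multi_deriv \<alpha> (\<lambda>_. 0) = (\<lambda>_. 0)"
  by (induction \<alpha>) (auto simp: multi_deriv_Cons partial_deriv_def)

lemma smooth_on_zero: "smooth_on \<Omega> (\<lambda>_. 0)"
  by (simp add: smooth_on_def multi_deriv_zero)

lemma smooth_on_diff:
  assumes "open \<Omega>" "smooth_on \<Omega> g" "smooth_on \<Omega> h"
  shows "smooth_on \<Omega> (\<lambda>y. g y - h y)"
  using smooth_on_lincomb[OF assms, of 1 "-1"] by simp

lemma multi_deriv_diff:
  assumes "open \<Omega>" "smooth_on \<Omega> g" "smooth_on \<Omega> h" "x \<in> \<Omega>"
  shows "multi_deriv \<alpha> (\<lambda>y. g y - h y) x = multi_deriv \<alpha> g x - multi_deriv \<alpha> h x"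
  using multi_deriv_lincomb[OF assms, of \<alpha> 1 "-1"] by simp

lemma smooth_on_sum:
  assumes "open \<Omega>" "finite I" "\<And>i. i \<in> I \<Longrightarrow> smooth_on \<Omega> (g i)"
  shows "smooth_on \<Omega> (\<lambda>y. \<Sum>i\<in>I. c i * g i y)"
  using assms(2,3)
proof (induction I rule: finite_induct)
  case (insert j I)
  then show ?case
    using smooth_on_lincomb[OF assms(1), of "g j" "\<lambda>y. \<Sum>i\<in>I. c i * g i y" "c j" 1] by simp
qed (simp add: smooth_on_zero)

lemma multi_deriv_sum:
  assumes "open \<Omega>" "finite I" "\<And>i. i \<in> I \<Longrightarrow> smooth_on \<Omega> (g i)" "x \<in> \<Omega>"
  shows "multi_deriv \<alpha> (\<lambda>y. \<Sum>i\<in>I. c i * g i y) x = (\<Sum>i\<in>I. c i * multi_deriv \<alpha> (g i) x)"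
  using assms(2,3)
proof (induction I rule: finite_induct)
  case (insert j I)
  then show ?case
    using multi_deriv_lincomb[OF assms(1), of "g j" "\<lambda>y. \<Sum>i\<in>I. c i * g i y" x \<alpha> "c j" 1]
    by (simp add: assms smooth_on_sum)
qed (simp add: multi_deriv_zero)


section \<open>Symmetry of second partial derivatives\<close>

text \<open>
  The second difference of \<open>g\<close> over a small square is, by two applications of the mean value
  theorem, a value of \<open>\<partial>\<^sub>j \<partial>\<^sub>i g\<close> inside the square; the difference itself does not depend on the
  order of \<open>i\<close> and \<open>j\<close>.
\<close>

lemma second_difference_mvt:
  fixes g :: "real^'n \<Rightarrow> real"
  assumes g: "smooth_on (ball x r) g" and h: "0 < h" "2 * h < r"
  obtains s t where "0 < s" "s < h" "0 < t" "t < h"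
    "g (x + h *\<^sub>R axis i 1 + h *\<^sub>R axis j 1) - g (x + h *\<^sub>R axis i 1)
       - g (x + h *\<^sub>R axis j 1) + g x
     = h\<^sup>2 * partial_deriv j (partial_deriv i g) (x + s *\<^sub>R axis i 1 + t *\<^sub>R axis j 1)"
proof -
  have inball: "x + a *\<^sub>R axis i 1 + b *\<^sub>R axis j 1 \<in> ball x r"
    if "0 \<le> a" "a \<le> h" "0 \<le> b" "b \<le> h" for a b
  proof -
    have "norm (a *\<^sub>R axis i 1 + b *\<^sub>R axis j (1::real) :: real^'n) \<le> a + b"
      using that by (intro order.trans[OF norm_triangle_ineq]) (simp add: norm_axis_1)
    also have "\<dots> < r" using that h by simp
    finally have "dist (x + (a *\<^sub>R axis i 1 + b *\<^sub>R axis j 1)) x < r"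
      unfolding dist_norm by simp
    then show ?thesis
      by (simp add: dist_commute add.assoc)
  qed
  have line: "((\<lambda>t. k (y + t *\<^sub>R axis l 1)) has_field_derivative
        partial_deriv l k (y + t *\<^sub>R axis l 1)) (at t)"
    if "smooth_on (ball x r) k" "y + t *\<^sub>R axis l 1 \<in> ball x r" for k y t and l :: 'n
    using DERIV_along_line[OF smooth_on_differentiable[OF that]]
    by (simp add: axis_def if_distrib[of "\<lambda>z. z * _"] cong: if_cong)
  define F where "F = (\<lambda>s. g (x + h *\<^sub>R axis j 1 + s *\<^sub>R axis i 1) - g (x + s *\<^sub>R axis i 1))"
  have "(F has_field_derivative
      partial_deriv i g (x + h *\<^sub>R axis j 1 + s *\<^sub>R axis i 1) - partial_deriv i g (x + s *\<^sub>R axis i 1)) (at s)"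
    if "0 \<le> s" "s \<le> h" for s
    unfolding F_def
    using that h inball[of s h] inball[of s 0] by (intro DERIV_diff line g) (auto simp: ac_simps)
  from MVT2[OF h(1) this] obtain s where s: "0 < s" "s < h"
    and Fs: "F h - F 0 = h * (partial_deriv i g (x + h *\<^sub>R axis j 1 + s *\<^sub>R axis i 1)
                 - partial_deriv i g (x + s *\<^sub>R axis i 1))"
    by auto
  have "((\<lambda>t. partial_deriv i g (x + s *\<^sub>R axis i 1 + t *\<^sub>R axis j 1)) has_field_derivative
      partial_deriv j (partial_deriv i g) (x + s *\<^sub>R axis i 1 + t *\<^sub>R axis j 1)) (at t)"
    if "0 \<le> t" "t \<le> h" for t
    using that s inball[of s t] by (intro line smooth_on_partial_deriv g) auto
  from MVT2[OF h(1) this] obtain t where t: "0 < t" "t < h"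
    and "partial_deriv i g (x + s *\<^sub>R axis i 1 + h *\<^sub>R axis j 1) - partial_deriv i g (x + s *\<^sub>R axis i 1)
       = h * partial_deriv j (partial_deriv i g) (x + s *\<^sub>R axis i 1 + t *\<^sub>R axis j 1)"
    by auto
  with Fs have "F h - F 0
      = h\<^sup>2 * partial_deriv j (partial_deriv i g) (x + s *\<^sub>R axis i 1 + t *\<^sub>R axis j 1)"
    by (simp add: ac_simps power2_eq_square)
  with s t show thesis
    by (intro that[of s t]) (auto simp: F_def algebra_simps)
qed

text \<open>
  Both mixed derivatives take a common value, up to a move of the argument, at points arbitrarily
  close to \<open>x\<close>. By continuity they agree at \<open>x\<close>.
\<close>

lemma partial_deriv_commute:
  fixes g :: "real^'n \<Rightarrow> real"
  assumes "open \<Omega>" "smooth_on \<Omega> g" "x \<in> \<Omega>"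
  shows "partial_deriv i (partial_deriv j g) x = partial_deriv j (partial_deriv i g) x"
proof (rule ccontr)
  let ?A = "partial_deriv i (partial_deriv j g)" and ?B = "partial_deriv j (partial_deriv i g)"
  assume "?A x \<noteq> ?B x"
  define \<delta> where "\<delta> = \<bar>?A x - ?B x\<bar> / 2"
  have \<delta>: "0 < \<delta>" using \<open>?A x \<noteq> ?B x\<close> by (simp add: \<delta>_def)
  obtain r0 where r0: "0 < r0" "ball x r0 \<subseteq> \<Omega>"
    using assms openE by blast
  have "continuous_on \<Omega> ?A" "continuous_on \<Omega> ?B"
    using smooth_on_multi_deriv_continuous[OF assms(2) order.refl, of "[i, j]"]
      smooth_on_multi_deriv_continuous[OF assms(2) order.refl, of "[j, i]"]
    by (simp_all add: multi_deriv_def)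
  then have "isCont ?A x" "isCont ?B x"
    using assms by (auto simp: continuous_on_eq_continuous_at)
  then obtain r1 r2 where r: "0 < r1" "0 < r2"
    "\<And>y. dist y x < r1 \<Longrightarrow> dist (?A y) (?A x) < \<delta>" "\<And>y. dist y x < r2 \<Longrightarrow> dist (?B y) (?B x) < \<delta>"
    unfolding continuous_at_eps_delta using \<delta> by metis
  define h where "h = Min {r0, r1, r2} / 3"
  have h: "0 < h" "2 * h < r0" "2 * h < r1" "2 * h < r2"
    using r0 r by (auto simp: h_def min_def)
  have near: "dist (x + a *\<^sub>R axis k 1 + b *\<^sub>R axis l 1) x < 2 * h"
    if "0 < a" "a < h" "0 < b" "b < h" for a b and k l :: 'n
  proof -
    have "norm (a *\<^sub>R axis k 1 + b *\<^sub>R axis l (1::real) :: real^'n) \<le> a + b"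
      using that by (intro order.trans[OF norm_triangle_ineq]) (simp add: norm_axis_1)
    with that show ?thesis
      by (simp add: dist_norm add.assoc)
  qed
  have sm: "smooth_on (ball x r0) g"
    using assms(2) r0(2) by (auto simp: smooth_on_def)
  obtain s t where st: "0 < s" "s < h" "0 < t" "t < h"
    "g (x + h *\<^sub>R axis i 1 + h *\<^sub>R axis j 1) - g (x + h *\<^sub>R axis i 1) - g (x + h *\<^sub>R axis j 1) + g x
       = h\<^sup>2 * ?B (x + s *\<^sub>R axis i 1 + t *\<^sub>R axis j 1)"
    using second_difference_mvt[OF sm h(1,2)] by metis
  obtain s' t' where st': "0 < s'" "s' < h" "0 < t'" "t' < h"
    "g (x + h *\<^sub>R axis j 1 + h *\<^sub>R axis i 1) - g (x + h *\<^sub>R axis j 1) - g (x + h *\<^sub>R axis i 1) + g x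
       = h\<^sup>2 * ?A (x + s' *\<^sub>R axis j 1 + t' *\<^sub>R axis i 1)"
    using second_difference_mvt[OF sm h(1,2)] by metis
  have sw: "x + h *\<^sub>R axis j 1 + h *\<^sub>R axis i 1 = x + h *\<^sub>R axis i 1 + h *\<^sub>R axis j 1"
    by (simp add: algebra_simps)
  have "h\<^sup>2 * ?B (x + s *\<^sub>R axis i 1 + t *\<^sub>R axis j 1) = h\<^sup>2 * ?A (x + s' *\<^sub>R axis j 1 + t' *\<^sub>R axis i 1)"
    using st(5) st'(5) unfolding sw by linarith
  then have eq: "?A (x + s' *\<^sub>R axis j 1 + t' *\<^sub>R axis i 1) = ?B (x + s *\<^sub>R axis i 1 + t *\<^sub>R axis j 1)"
    using h(1) by simp
  have "dist (?A (x + s' *\<^sub>R axis j 1 + t' *\<^sub>R axis i 1)) (?A x) < \<delta>"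
    "dist (?B (x + s *\<^sub>R axis i 1 + t *\<^sub>R axis j 1)) (?B x) < \<delta>"
    using near[of s' t' j i] near[of s t i j] st st' h by (auto intro!: r(3,4))
  then have "\<bar>?A x - ?B x\<bar> < 2 * \<delta>"
    unfolding eq dist_real_def by linarith
  then show False by (simp add: \<delta>_def)
qed


section \<open>Taylor expansion along a segment\<close>

definition dir_deriv :: "real^'n \<Rightarrow> (real^'n \<Rightarrow> real) \<Rightarrow> real^'n \<Rightarrow> real" where
  "dir_deriv v g y = (\<Sum>i\<in>UNIV. v $ i * partial_deriv i g y)"

lemma smooth_on_dir_deriv:
  "open \<Omega> \<Longrightarrow> smooth_on \<Omega> g \<Longrightarrow> smooth_on \<Omega> (dir_deriv v g)"
  unfolding dir_deriv_def by (intro smooth_on_sum smooth_on_partial_deriv) auto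

lemma smooth_on_dir_deriv_power:
  "open \<Omega> \<Longrightarrow> smooth_on \<Omega> g \<Longrightarrow> smooth_on \<Omega> ((dir_deriv v ^^ n) g)"
  by (induction n) (auto intro: smooth_on_dir_deriv)

lemma dir_deriv_twice:
  assumes "open \<Omega>" "smooth_on \<Omega> g" "x \<in> \<Omega>"
  shows "dir_deriv v (dir_deriv v g) x
    = (\<Sum>i\<in>UNIV. \<Sum>j\<in>UNIV. v $ i * v $ j * partial_deriv i (partial_deriv j g) x)"
proof -
  have "partial_deriv i (dir_deriv v g) x = (\<Sum>j\<in>UNIV. v $ j * partial_deriv i (partial_deriv j g) x)" for i
    using multi_deriv_sum[OF assms(1) finite smooth_on_partial_deriv[OF assms(2)] assms(3), of "[i]" "($) v"]
    by (simp add: multi_deriv_def dir_deriv_def[abs_def])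
  then show ?thesis
    by (simp add: dir_deriv_def[of v "dir_deriv v g"] sum_distrib_left mult.assoc)
qed

text \<open>
  An \<open>n\<close>-fold directional derivative is a combination of the partial derivatives of order \<open>n\<close>
  whose weights, products of \<open>n\<close> components of \<open>v\<close>, have absolute values summing up to
  \<open>(\<Sum>i. \<bar>v $ i\<bar>) ^ n\<close>.
\<close>

lemma dir_deriv_power_bound:
  fixes g :: "real^'n \<Rightarrow> real"
  assumes "open \<Omega>" "smooth_on \<Omega> g" "x \<in> \<Omega>" "\<And>\<alpha>. length \<alpha> = n \<Longrightarrow> \<bar>multi_deriv \<alpha> g x\<bar> \<le> B"
  shows "\<bar>(dir_deriv v ^^ n) g x\<bar> \<le> (\<Sum>i\<in>UNIV. \<bar>v $ i\<bar>) ^ n * B"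
  using assms(2,4)
proof (induction n arbitrary: g B)
  case (Suc n)
  have "\<bar>multi_deriv \<alpha> (dir_deriv v g) x\<bar> \<le> (\<Sum>i\<in>UNIV. \<bar>v $ i\<bar>) * B" if "length \<alpha> = n" for \<alpha>
  proof -
    have "multi_deriv \<alpha> (dir_deriv v g) x = (\<Sum>i\<in>UNIV. v $ i * multi_deriv (\<alpha> @ [i]) g x)"
      using Suc.prems(1) assms(1,3) unfolding dir_deriv_def multi_deriv_snoc
      by (intro multi_deriv_sum smooth_on_partial_deriv) auto
    also have "\<bar>\<dots>\<bar> \<le> (\<Sum>i\<in>UNIV. \<bar>v $ i\<bar> * B)"
      using Suc.prems(2) that
      by (intro order.trans[OF sum_abs] sum_mono) (auto simp: abs_mult intro!: mult_left_mono)
    finally show ?thesis by (simp add: sum_distrib_right)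
  qed
  from Suc.IH[OF smooth_on_dir_deriv[OF assms(1) Suc.prems(1)] this]
  show ?case by (simp add: funpow_swap1 mult_ac)
qed simp

text \<open>
  The one-variable Taylor formula for \<open>t \<mapsto> g (x + t v)\<close> on \<open>[0, 1]\<close>. The remainder is kept in terms
  of a bound on the partial derivatives of order \<open>n\<close>, since that is the quantity controlled by
  moderateness; the factor \<open>1 / n!\<close> is discarded.
\<close>

lemma taylor_segment:
  fixes g :: "real^'n \<Rightarrow> real"
  assumes \<Omega>: "open \<Omega>" and g: "smooth_on \<Omega> g" and n: "0 < n"
    and seg: "\<And>t. 0 \<le> t \<Longrightarrow> t \<le> 1 \<Longrightarrow> x + t *\<^sub>R v \<in> K" and K: "K \<subseteq> \<Omega>"
    and B: "\<And>\<alpha> y. length \<alpha> = n \<Longrightarrow> y \<in> K \<Longrightarrow> \<bar>multi_deriv \<alpha> g y\<bar> \<le> B"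
  shows "\<bar>g (x + v) - (\<Sum>m<n. (dir_deriv v ^^ m) g x / fact m)\<bar> \<le> (\<Sum>i\<in>UNIV. \<bar>v $ i\<bar>) ^ n * B"
proof -
  define \<phi> where "\<phi> m t = (dir_deriv v ^^ m) g (x + t *\<^sub>R v)" for m t
  have "(\<phi> m has_field_derivative \<phi> (Suc m) t) (at t)" if "0 \<le> t" "t \<le> 1" for m t
    using DERIV_along_line[OF smooth_on_differentiable[OF smooth_on_dir_deriv_power[OF \<Omega> g]], where x = x and v = v]
      seg[OF that] K unfolding \<phi>_def[abs_def] by (auto simp: dir_deriv_def)
  then obtain t where t: "0 < t" "t < 1"
    "\<phi> 0 1 = (\<Sum>m<n. \<phi> m 0 / fact m * 1 ^ m) + \<phi> n t / fact n * 1 ^ n"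
    using Maclaurin[of 1 n \<phi> "\<phi> 0"] n by auto
  have "\<bar>\<phi> n t / fact n\<bar> \<le> \<bar>\<phi> n t\<bar>"
    by (simp add: divide_le_eq mult_le_cancel_left1 fact_ge_1)
  also have "\<dots> \<le> (\<Sum>i\<in>UNIV. \<bar>v $ i\<bar>) ^ n * B"
    unfolding \<phi>_def using t seg[of t] K by (intro dir_deriv_power_bound[OF \<Omega> g] B) auto
  finally show ?thesis
    using t(3) by (simp add: \<phi>_def)
qed

section \<open>Nets and their classes\<close>

lemma eventually_unit: "\<forall>\<^sub>F \<epsilon> in at_right (0::real). \<epsilon> \<in> {0<..1}"
  using eventually_at_right_real[of 0 "1::real"] by (auto elim: eventually_mono)

lemma bigo_at_right_0_iff:
  fixes x g :: "real \<Rightarrow> real"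
  shows "x \<in> O[at_right 0](g) \<longleftrightarrow> (\<exists>C>0. \<forall>\<^sub>F \<epsilon> in at_right 0. \<bar>x \<epsilon>\<bar> \<le> C * \<bar>g \<epsilon>\<bar>)"
  by (auto elim!: landau_o.bigE intro: landau_o.bigI)

lemma moderate_net_iff:
  "moderate_net x \<longleftrightarrow> (\<exists>N. \<exists>C>0. \<forall>\<^sub>F \<epsilon> in at_right 0. \<bar>x \<epsilon>\<bar> \<le> C / \<epsilon> ^ N)"
proof -
  have "(\<forall>\<^sub>F \<epsilon> in at_right 0. \<bar>x \<epsilon>\<bar> \<le> C * \<bar>1 / \<epsilon> ^ N\<bar>) \<longleftrightarrow> (\<forall>\<^sub>F \<epsilon> in at_right 0. \<bar>x \<epsilon>\<bar> \<le> C / \<epsilon> ^ N)"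
    for C N by (rule eventually_cong[OF eventually_unit]) auto
  then show ?thesis by (simp add: moderate_net_def bigo_at_right_0_iff)
qed

lemma negligible_net_iff:
  "negligible_net x \<longleftrightarrow> (\<forall>m. \<exists>C>0. \<forall>\<^sub>F \<epsilon> in at_right 0. \<bar>x \<epsilon>\<bar> \<le> C * \<epsilon> ^ m)"
proof -
  have "(\<forall>\<^sub>F \<epsilon> in at_right 0. \<bar>x \<epsilon>\<bar> \<le> C * \<bar>\<epsilon> ^ m\<bar>) \<longleftrightarrow> (\<forall>\<^sub>F \<epsilon> in at_right 0. \<bar>x \<epsilon>\<bar> \<le> C * \<epsilon> ^ m)"
    for C m by (rule eventually_cong[OF eventually_unit]) auto
  then show ?thesis by (simp add: negligible_net_def bigo_at_right_0_iff)
qed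

lemma negligible_net_0: "negligible_net (\<lambda>_. 0)"
  by (simp add: negligible_net_def)

lemma moderate_net_sum:
  "finite I \<Longrightarrow> (\<And>i. i \<in> I \<Longrightarrow> moderate_net (x i)) \<Longrightarrow> moderate_net (\<lambda>\<epsilon>. \<Sum>i\<in>I. x i \<epsilon>)"
  by (induction I rule: finite_induct) (auto intro: moderate_net_const moderate_net_add)

lemma negligible_net_sum:
  "finite I \<Longrightarrow> (\<And>i. i \<in> I \<Longrightarrow> negligible_net (x i)) \<Longrightarrow> negligible_net (\<lambda>\<epsilon>. \<Sum>i\<in>I. x i \<epsilon>)"
  by (induction I rule: finite_induct) (auto intro: negligible_net_0 negligible_net_add)

lemma moderate_net_abs: "moderate_net x \<Longrightarrow> moderate_net (\<lambda>\<epsilon>. \<bar>x \<epsilon>\<bar>)"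
  by (simp add: moderate_net_iff)

lemma abs_gen_real_sum:
  assumes "finite I" "\<And>i. i \<in> I \<Longrightarrow> moderate_net (x i)"
  shows "(\<Sum>i\<in>I. abs_gen_real (x i)) = abs_gen_real (\<lambda>\<epsilon>. \<Sum>i\<in>I. x i \<epsilon>)"
  using assms
  by (induction I rule: finite_induct)
     (auto simp: zero_gen_real_def abs_gen_real_plus moderate_net_sum)

lemma abs_gen_real_diff:
  assumes "moderate_net x" "moderate_net y"
  shows "abs_gen_real x - abs_gen_real y = abs_gen_real (\<lambda>\<epsilon>. x \<epsilon> - y \<epsilon>)"
proof -
  have "- abs_gen_real y = abs_gen_real (\<lambda>\<epsilon>. - y \<epsilon>)"
    using assms by (simp add: uminus_gen_real.abs_eq net_eq_self_iff)
  then show ?thesis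
    using assms abs_gen_real_plus[of x "\<lambda>\<epsilon>. - y \<epsilon>"]
    by (simp add: moderate_net_uminus minus_gen_real_def)
qed

lemma gen_real_cases:
  obtains x where "moderate_net x" "X = abs_gen_real x"
  using Quotient3_abs_rep[OF Quotient3_gen_real, of X] Quotient3_rep_reflp[OF Quotient3_gen_real, of X]
  by (metis net_eq_self_iff)

text \<open>
  The negative part of a net that is bounded below by \<open>-C \<epsilon> ^ m\<close> for every \<open>m\<close> is negligible, so
  replacing the net by its positive part does not change its class.
\<close>

lemma zero_le_abs_gen_real_iff:
  assumes "moderate_net a"
  shows "0 \<le> abs_gen_real a \<longleftrightarrow> (\<forall>m. \<exists>C>0. \<forall>\<^sub>F \<epsilon> in at_right 0. - (C * \<epsilon> ^ m) \<le> a \<epsilon>)"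
proof
  assume "0 \<le> abs_gen_real a"
  then obtain x where x: "moderate_net x" "abs_gen_real a = abs_gen_real x" "\<forall>\<epsilon>\<in>{0<..1}. 0 \<le> x \<epsilon>"
    by (auto simp: less_eq_gen_real_def gen_nonneg_def)
  then have "negligible_net (\<lambda>\<epsilon>. a \<epsilon> - x \<epsilon>)"
    using assms by (simp add: abs_gen_real_eq_iff)
  then have *: "\<exists>C>0. \<forall>\<^sub>F \<epsilon> in at_right 0. \<bar>a \<epsilon> - x \<epsilon>\<bar> \<le> C * \<epsilon> ^ m" for m
    by (simp add: negligible_net_iff)
  show "\<forall>m. \<exists>C>0. \<forall>\<^sub>F \<epsilon> in at_right 0. - (C * \<epsilon> ^ m) \<le> a \<epsilon>"
  proof
    fix m
    obtain C where C: "C > 0" "\<forall>\<^sub>F \<epsilon> in at_right 0. \<bar>a \<epsilon> - x \<epsilon>\<bar> \<le> C * \<epsilon> ^ m"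
      using * by blast
    from C(2) eventually_unit have "\<forall>\<^sub>F \<epsilon> in at_right 0. - (C * \<epsilon> ^ m) \<le> a \<epsilon>"
      by eventually_elim (use x(3) in force)
    with C(1) show "\<exists>C>0. \<forall>\<^sub>F \<epsilon> in at_right 0. - (C * \<epsilon> ^ m) \<le> a \<epsilon>" by blast
  qed
next
  assume L: "\<forall>m. \<exists>C>0. \<forall>\<^sub>F \<epsilon> in at_right 0. - (C * \<epsilon> ^ m) \<le> a \<epsilon>"
  let ?x = "\<lambda>\<epsilon>. max 0 (a \<epsilon>)"
  have "negligible_net (\<lambda>\<epsilon>. a \<epsilon> - ?x \<epsilon>)"
    unfolding negligible_net_iff
  proof
    fix m
    obtain C where C: "C > 0" "\<forall>\<^sub>F \<epsilon> in at_right 0. - (C * \<epsilon> ^ m) \<le> a \<epsilon>"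
      using L by blast
    from C(2) eventually_unit have "\<forall>\<^sub>F \<epsilon> in at_right 0. \<bar>a \<epsilon> - ?x \<epsilon>\<bar> \<le> C * \<epsilon> ^ m"
      by eventually_elim (use C(1) in \<open>auto simp: max_def\<close>)
    with C(1) show "\<exists>C>0. \<forall>\<^sub>F \<epsilon> in at_right 0. \<bar>a \<epsilon> - ?x \<epsilon>\<bar> \<le> C * \<epsilon> ^ m" by blast
  qed
  moreover have "moderate_net ?x"
  proof -
    have "moderate_net (\<lambda>\<epsilon>. (1 / 2) * (a \<epsilon> + \<bar>a \<epsilon>\<bar>))"
      using assms by (intro moderate_net_mult moderate_net_const moderate_net_add moderate_net_abs)
    moreover have "(\<lambda>\<epsilon>. (1 / 2) * (a \<epsilon> + \<bar>a \<epsilon>\<bar>)) = ?x" by (auto simp: max_def)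
    ultimately show ?thesis by simp
  qed
  ultimately have "gen_nonneg (abs_gen_real a)"
    using assms unfolding gen_nonneg_def
    by (intro exI[of _ ?x]) (simp add: abs_gen_real_eq_iff)
  then show "0 \<le> abs_gen_real a" by (simp add: less_eq_gen_real_def)
qed

subsection \<open>Nets of smooth functions\<close>

text \<open>
  On a nonempty compact set the supremum of a continuous function bounds every value, so a Landau
  estimate for suprema is a pointwise estimate with a uniform constant. In this form the estimates can
  be used without any further reference to suprema.
\<close>

lemma SUP_bigo_iff:
  fixes u :: "real \<Rightarrow> real^'n \<Rightarrow> real" and g :: "real \<Rightarrow> real"
  assumes u: "\<forall>\<epsilon>\<in>{0<..1}. smooth_on \<Omega> (u \<epsilon>)" and K: "compact K" "K \<subseteq> \<Omega>" "K \<noteq> {}"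
  shows "(\<lambda>\<epsilon>. SUP x\<in>K. \<bar>multi_deriv \<alpha> (u \<epsilon>) x\<bar>) \<in> O[at_right 0](g)
    \<longleftrightarrow> (\<exists>C>0. \<forall>\<^sub>F \<epsilon> in at_right 0. \<forall>x\<in>K. \<bar>multi_deriv \<alpha> (u \<epsilon>) x\<bar> \<le> C * \<bar>g \<epsilon>\<bar>)"
proof -
  have *: "\<bar>SUP x\<in>K. \<bar>multi_deriv \<alpha> (u \<epsilon>) x\<bar>\<bar> \<le> b \<longleftrightarrow> (\<forall>x\<in>K. \<bar>multi_deriv \<alpha> (u \<epsilon>) x\<bar> \<le> b)"
    if "\<epsilon> \<in> {0<..1}" for \<epsilon> b
  proof -
    have "continuous_on K (\<lambda>x. \<bar>multi_deriv \<alpha> (u \<epsilon>) x\<bar>)"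
      using u that K by (intro continuous_intros smooth_on_multi_deriv_continuous) auto
    then have bdd: "bdd_above ((\<lambda>x. \<bar>multi_deriv \<alpha> (u \<epsilon>) x\<bar>) ` K)"
      using K by (intro compact_imp_bounded[THEN bounded_imp_bdd_above] compact_continuous_image)
    obtain x0 where "x0 \<in> K" using K by blast
    have "0 \<le> (SUP x\<in>K. \<bar>multi_deriv \<alpha> (u \<epsilon>) x\<bar>)"
      by (rule cSUP_upper2[OF bdd \<open>x0 \<in> K\<close>]) simp
    then show ?thesis
      using cSUP_le_iff[OF K(3) bdd] by simp
  qed
  have "(\<forall>\<^sub>F \<epsilon> in at_right 0. \<bar>SUP x\<in>K. \<bar>multi_deriv \<alpha> (u \<epsilon>) x\<bar>\<bar> \<le> C * \<bar>g \<epsilon>\<bar>) \<longleftrightarrow>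
      (\<forall>\<^sub>F \<epsilon> in at_right 0. \<forall>x\<in>K. \<bar>multi_deriv \<alpha> (u \<epsilon>) x\<bar> \<le> C * \<bar>g \<epsilon>\<bar>)" for C
    by (rule eventually_cong[OF eventually_unit]) (rule *)
  then show ?thesis
    by (simp add: bigo_at_right_0_iff)
qed

lemma moderate_fun_nets_iff:
  "u \<in> moderate_fun_nets \<Omega> \<longleftrightarrow> (\<forall>\<epsilon>\<in>{0<..1}. smooth_on \<Omega> (u \<epsilon>)) \<and>
     (\<forall>K \<alpha>. compact K \<and> K \<subseteq> \<Omega> \<longrightarrow>
       (\<exists>N. \<exists>C>0. \<forall>\<^sub>F \<epsilon> in at_right 0. \<forall>x\<in>K. \<bar>multi_deriv \<alpha> (u \<epsilon>) x\<bar> \<le> C / \<epsilon> ^ N))"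
  (is "_ \<longleftrightarrow> ?S \<and> ?B")
proof (cases ?S)
  case True
  have eq: "(\<lambda>\<epsilon>. SUP x\<in>K. \<bar>multi_deriv \<alpha> (u \<epsilon>) x\<bar>) \<in> O[at_right 0](\<lambda>\<epsilon>. 1 / \<epsilon> ^ N) \<longleftrightarrow> (\<exists>C>0. \<forall>\<^sub>F \<epsilon> in at_right 0. \<forall>x\<in>K. \<bar>multi_deriv \<alpha> (u \<epsilon>) x\<bar> \<le> C / \<epsilon> ^ N)"
    if "compact K" "K \<subseteq> \<Omega>" "K \<noteq> {}" for K \<alpha> N
    unfolding SUP_bigo_iff[OF True that]
    by (intro ex_cong1 conj_cong refl eventually_cong[OF eventually_unit]) auto
  have "(compact K \<and> K \<subseteq> \<Omega> \<and> K \<noteq> {} \<longrightarrow> (\<exists>N::nat. (\<lambda>\<epsilon>. SUP x\<in>K. \<bar>multi_deriv \<alpha> (u \<epsilon>) x\<bar>) \<in> O[at_right 0](\<lambda>\<epsilon>. 1 / \<epsilon> ^ N))) \<longleftrightarrow>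
      (compact K \<and> K \<subseteq> \<Omega> \<longrightarrow> (\<exists>N::nat. \<exists>C>0. \<forall>\<^sub>F \<epsilon> in at_right 0. \<forall>x\<in>K. \<bar>multi_deriv \<alpha> (u \<epsilon>) x\<bar> \<le> C / \<epsilon> ^ N))" for K \<alpha>
    using eq[of K \<alpha>] gt_ex[of "0::real"] by (cases "K = {}") auto
  then show ?thesis
    by (simp only: moderate_fun_nets_def mem_Collect_eq)
next
  case False
  then show ?thesis unfolding moderate_fun_nets_def by blast
qed

lemma negligible_fun_nets_iff:
  "u \<in> negligible_fun_nets \<Omega> \<longleftrightarrow> (\<forall>\<epsilon>\<in>{0<..1}. smooth_on \<Omega> (u \<epsilon>)) \<and>
     (\<forall>K \<alpha> m. compact K \<and> K \<subseteq> \<Omega> \<longrightarrow>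
       (\<exists>C>0. \<forall>\<^sub>F \<epsilon> in at_right 0. \<forall>x\<in>K. \<bar>multi_deriv \<alpha> (u \<epsilon>) x\<bar> \<le> C * \<epsilon> ^ m))"
  (is "_ \<longleftrightarrow> ?S \<and> ?B")
proof (cases ?S)
  case True
  have eq: "(\<lambda>\<epsilon>. SUP x\<in>K. \<bar>multi_deriv \<alpha> (u \<epsilon>) x\<bar>) \<in> O[at_right 0](\<lambda>\<epsilon>. \<epsilon> ^ m) \<longleftrightarrow> (\<exists>C>0. \<forall>\<^sub>F \<epsilon> in at_right 0. \<forall>x\<in>K. \<bar>multi_deriv \<alpha> (u \<epsilon>) x\<bar> \<le> C * \<epsilon> ^ m)"
    if "compact K" "K \<subseteq> \<Omega>" "K \<noteq> {}" for K \<alpha> m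
    unfolding SUP_bigo_iff[OF True that]
    by (intro ex_cong1 conj_cong refl eventually_cong[OF eventually_unit]) auto
  have "(compact K \<and> K \<subseteq> \<Omega> \<and> K \<noteq> {} \<longrightarrow> (\<forall>m::nat. (\<lambda>\<epsilon>. SUP x\<in>K. \<bar>multi_deriv \<alpha> (u \<epsilon>) x\<bar>) \<in> O[at_right 0](\<lambda>\<epsilon>. \<epsilon> ^ m))) \<longleftrightarrow>
      (\<forall>m. compact K \<and> K \<subseteq> \<Omega> \<longrightarrow> (\<exists>C>0. \<forall>\<^sub>F \<epsilon> in at_right 0. \<forall>x\<in>K. \<bar>multi_deriv \<alpha> (u \<epsilon>) x\<bar> \<le> C * \<epsilon> ^ m))" for K \<alpha>
    using eq[of K \<alpha>] gt_ex[of "0::real"] by (cases "K = {}") auto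
  then show ?thesis
    by (simp only: negligible_fun_nets_def mem_Collect_eq)
next
  case False
  then show ?thesis unfolding negligible_fun_nets_def by blast
qed

lemma moderate_fun_nets_smooth: "u \<in> moderate_fun_nets \<Omega> \<Longrightarrow> \<epsilon> \<in> {0<..1} \<Longrightarrow> smooth_on \<Omega> (u \<epsilon>)"
  by (simp add: moderate_fun_nets_def)

lemma moderate_fun_nets_bound:
  assumes "u \<in> moderate_fun_nets \<Omega>" "compact K" "K \<subseteq> \<Omega>"
  shows "\<exists>N. \<exists>C>0. \<forall>\<^sub>F \<epsilon> in at_right 0. \<forall>x\<in>K. \<bar>multi_deriv \<alpha> (u \<epsilon>) x\<bar> \<le> C / \<epsilon> ^ N"
  using assms by (simp add: moderate_fun_nets_iff)

lemma negligible_fun_nets_bound: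
  assumes "u \<in> negligible_fun_nets \<Omega>" "compact K" "K \<subseteq> \<Omega>"
  shows "\<exists>C>0. \<forall>\<^sub>F \<epsilon> in at_right 0. \<forall>x\<in>K. \<bar>multi_deriv \<alpha> (u \<epsilon>) x\<bar> \<le> C * \<epsilon> ^ m"
  using assms by (simp add: negligible_fun_nets_iff)

text \<open>
  There are finitely many multi-indices of a given order, so one power of \<open>\<epsilon>\<close> and one constant
  serve them all. This is the form of hypothesis that \<open>taylor_segment\<close> asks for.
\<close>

lemma moderate_fun_nets_bound_order:
  fixes u :: "real \<Rightarrow> real^'n \<Rightarrow> real"
  assumes u: "u \<in> moderate_fun_nets \<Omega>" and K: "compact K" "K \<subseteq> \<Omega>"
  shows "\<exists>N. \<exists>C>0. \<forall>\<^sub>F \<epsilon> in at_right 0.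
    \<forall>\<alpha>. length \<alpha> = n \<longrightarrow> (\<forall>x\<in>K. \<bar>multi_deriv \<alpha> (u \<epsilon>) x\<bar> \<le> C / \<epsilon> ^ N)"
proof -
  let ?A = "{\<alpha> :: 'n list. length \<alpha> = n}"
  have fin: "finite ?A"
    using finite_lists_length_eq[of "UNIV :: 'n set" n] by simp
  define P where "P \<alpha> N C \<longleftrightarrow>
    C > 0 \<and> (\<forall>\<^sub>F \<epsilon> in at_right 0. \<forall>x\<in>K. \<bar>multi_deriv \<alpha> (u \<epsilon>) x\<bar> \<le> C / \<epsilon> ^ N)" for \<alpha> N C
  have "\<exists>N C. P \<alpha> N C" for \<alpha>
    using moderate_fun_nets_bound[OF u K] by (simp add: P_def)
  then obtain N C where "\<And>\<alpha>. P \<alpha> (N \<alpha>) (C \<alpha>)"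
    by metis
  then have NC: "\<And>\<alpha>. C \<alpha> > 0"
    "\<And>\<alpha>. \<forall>\<^sub>F \<epsilon> in at_right 0. \<forall>x\<in>K. \<bar>multi_deriv \<alpha> (u \<epsilon>) x\<bar> \<le> C \<alpha> / \<epsilon> ^ N \<alpha>"
    by (simp_all add: P_def)
  define N' C' where "N' = sum N ?A" and "C' = 1 + sum C ?A"
  have N': "N \<alpha> \<le> N'" if "\<alpha> \<in> ?A" for \<alpha>
    unfolding N'_def using that fin by (intro member_le_sum) auto
  have C0: "0 \<le> C \<alpha>" for \<alpha>
    using NC(1)[of \<alpha>] by simp
  have C': "C \<alpha> \<le> C'" if "\<alpha> \<in> ?A" for \<alpha>
    using member_le_sum[OF that _ fin, of C] C0 by (simp add: C'_def)
  have "0 \<le> sum C ?A"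
    using C0 by (intro sum_nonneg) simp
  then have "C' > 0" by (simp add: C'_def)
  have "\<forall>\<^sub>F \<epsilon> in at_right 0. \<forall>\<alpha>\<in>?A. \<forall>x\<in>K. \<bar>multi_deriv \<alpha> (u \<epsilon>) x\<bar> \<le> C \<alpha> / \<epsilon> ^ N \<alpha>"
    by (rule eventually_ball_finite[OF fin]) (rule ballI, rule NC(2))
  with eventually_unit have "\<forall>\<^sub>F \<epsilon> in at_right 0. \<forall>\<alpha>\<in>?A. \<forall>x\<in>K. \<bar>multi_deriv \<alpha> (u \<epsilon>) x\<bar> \<le> C' / \<epsilon> ^ N'"
  proof eventually_elim
    case (elim \<epsilon>)
    have "C \<alpha> / \<epsilon> ^ N \<alpha> \<le> C' / \<epsilon> ^ N'" if "\<alpha> \<in> ?A" for \<alpha>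
      using elim(1) that C' N' NC(1)[of \<alpha>] \<open>C' > 0\<close> by (intro frac_le power_decreasing) (auto intro: less_imp_le)
    then show ?case using elim(2) by (blast intro: order.trans)
  qed
  with \<open>C' > 0\<close> show ?thesis by auto
qed

lemma negligible_fun_nets_lincomb:
  fixes u v :: "real \<Rightarrow> real^'n \<Rightarrow> real"
  assumes \<Omega>: "open \<Omega>" and u: "u \<in> negligible_fun_nets \<Omega>" and v: "v \<in> negligible_fun_nets \<Omega>"
  shows "(\<lambda>\<epsilon> x. a * u \<epsilon> x + b * v \<epsilon> x) \<in> negligible_fun_nets \<Omega>"
  unfolding negligible_fun_nets_iff
proof (intro conjI ballI allI impI)
  have sm: "smooth_on \<Omega> (u \<epsilon>)" "smooth_on \<Omega> (v \<epsilon>)" if "\<epsilon> \<in> {0<..1}" for \<epsilon>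
    using u v that by (simp_all add: negligible_fun_nets_def)
  then show "smooth_on \<Omega> (\<lambda>x. a * u \<epsilon> x + b * v \<epsilon> x)" if "\<epsilon> \<in> {0<..1}" for \<epsilon>
    using that by (intro smooth_on_lincomb \<Omega>)
  fix K \<alpha> m assume K: "compact K \<and> K \<subseteq> \<Omega>"
  then obtain C D where CD: "C > 0" "D > 0"
    "\<forall>\<^sub>F \<epsilon> in at_right 0. \<forall>x\<in>K. \<bar>multi_deriv \<alpha> (u \<epsilon>) x\<bar> \<le> C * \<epsilon> ^ m"
    "\<forall>\<^sub>F \<epsilon> in at_right 0. \<forall>x\<in>K. \<bar>multi_deriv \<alpha> (v \<epsilon>) x\<bar> \<le> D * \<epsilon> ^ m"
    using negligible_fun_nets_bound[OF u, of K \<alpha> m] negligible_fun_nets_bound[OF v, of K \<alpha> m] by blast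
  let ?E = "1 + \<bar>a\<bar> * C + \<bar>b\<bar> * D"
  from CD(3,4) eventually_unit
  have "\<forall>\<^sub>F \<epsilon> in at_right 0. \<forall>x\<in>K. \<bar>multi_deriv \<alpha> (\<lambda>x. a * u \<epsilon> x + b * v \<epsilon> x) x\<bar> \<le> ?E * \<epsilon> ^ m"
  proof eventually_elim
    case (elim \<epsilon>)
    show ?case
    proof
      fix x assume x: "x \<in> K"
      have "\<bar>multi_deriv \<alpha> (\<lambda>x. a * u \<epsilon> x + b * v \<epsilon> x) x\<bar>
          = \<bar>a * multi_deriv \<alpha> (u \<epsilon>) x + b * multi_deriv \<alpha> (v \<epsilon>) x\<bar>"
        using x K elim(3) by (subst multi_deriv_lincomb[OF \<Omega> sm]) auto
      also have "\<dots> \<le> \<bar>a\<bar> * \<bar>multi_deriv \<alpha> (u \<epsilon>) x\<bar> + \<bar>b\<bar> * \<bar>multi_deriv \<alpha> (v \<epsilon>) x\<bar>"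
        by (simp add: abs_mult[symmetric] abs_triangle_ineq)
      also have "\<dots> \<le> \<bar>a\<bar> * (C * \<epsilon> ^ m) + \<bar>b\<bar> * (D * \<epsilon> ^ m)"
        using elim(1,2) x by (intro add_mono mult_left_mono) auto
      also have "\<dots> \<le> ?E * \<epsilon> ^ m"
        using elim(3) by (simp add: algebra_simps)
      finally show "\<bar>multi_deriv \<alpha> (\<lambda>x. a * u \<epsilon> x + b * v \<epsilon> x) x\<bar> \<le> ?E * \<epsilon> ^ m" .
    qed
  qed
  moreover have "?E > 0"
    using CD(1,2) by (intro add_pos_nonneg) auto
  ultimately show "\<exists>C>0. \<forall>\<^sub>F \<epsilon> in at_right 0.
      \<forall>x\<in>K. \<bar>multi_deriv \<alpha> (\<lambda>x. a * u \<epsilon> x + b * v \<epsilon> x) x\<bar> \<le> C * \<epsilon> ^ m"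
    by blast
qed

lemma equiv_fun_net_rel:
  assumes "open \<Omega>"
  shows "equiv (moderate_fun_nets \<Omega>) (fun_net_rel \<Omega>)"
proof (rule equivI)
  show "fun_net_rel \<Omega> \<subseteq> moderate_fun_nets \<Omega> \<times> moderate_fun_nets \<Omega>"
    by (auto simp: fun_net_rel_def)
  have "(\<lambda>\<epsilon> x. 0) \<in> negligible_fun_nets \<Omega>"
    unfolding negligible_fun_nets_iff
    by (auto simp: smooth_on_zero multi_deriv_zero intro!: exI[of _ 1]
        eventually_mono[OF eventually_unit])
  then show "refl_on (moderate_fun_nets \<Omega>) (fun_net_rel \<Omega>)"
    by (auto simp: refl_on_def fun_net_rel_def)
  show "sym (fun_net_rel \<Omega>)"
  proof (rule symI)
    fix u v assume "(u, v) \<in> fun_net_rel \<Omega>"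
    then show "(v, u) \<in> fun_net_rel \<Omega>"
      using negligible_fun_nets_lincomb[OF assms, of "\<lambda>\<epsilon> x. u \<epsilon> x - v \<epsilon> x" "\<lambda>\<epsilon> x. u \<epsilon> x - v \<epsilon> x" "-1" 0]
      by (simp add: fun_net_rel_def)
  qed
  show "trans (fun_net_rel \<Omega>)"
  proof (rule transI)
    fix u v w assume "(u, v) \<in> fun_net_rel \<Omega>" "(v, w) \<in> fun_net_rel \<Omega>"
    then show "(u, w) \<in> fun_net_rel \<Omega>"
      using negligible_fun_nets_lincomb[OF assms, of "\<lambda>\<epsilon> x. u \<epsilon> x - v \<epsilon> x" "\<lambda>\<epsilon> x. v \<epsilon> x - w \<epsilon> x" 1 1]
      by (simp add: fun_net_rel_def)
  qed
qed

lemma moderate_fun_nets_partial_deriv: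
  assumes "u \<in> moderate_fun_nets \<Omega>"
  shows "(\<lambda>\<epsilon>. partial_deriv i (u \<epsilon>)) \<in> moderate_fun_nets \<Omega>"
  using assms unfolding moderate_fun_nets_iff
  by (auto simp: smooth_on_partial_deriv multi_deriv_snoc[symmetric])

lemma fun_net_rel_partial_deriv:
  fixes u v :: "real \<Rightarrow> real^'n \<Rightarrow> real"
  assumes \<Omega>: "open \<Omega>" and uv: "(u, v) \<in> fun_net_rel \<Omega>"
  shows "(\<lambda>\<epsilon>. partial_deriv i (u \<epsilon>), \<lambda>\<epsilon>. partial_deriv i (v \<epsilon>)) \<in> fun_net_rel \<Omega>"
proof -
  have mod: "u \<in> moderate_fun_nets \<Omega>" "v \<in> moderate_fun_nets \<Omega>"
    and neg: "(\<lambda>\<epsilon> x. u \<epsilon> x - v \<epsilon> x) \<in> negligible_fun_nets \<Omega>"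
    using uv by (auto simp: fun_net_rel_def)
  note sm = mod[THEN moderate_fun_nets_smooth]
  have eq: "multi_deriv \<alpha> (\<lambda>x. partial_deriv i (u \<epsilon>) x - partial_deriv i (v \<epsilon>) x) x
      = multi_deriv (\<alpha> @ [i]) (\<lambda>x. u \<epsilon> x - v \<epsilon> x) x"
    if "\<epsilon> \<in> {0<..1}" "x \<in> \<Omega>" for \<alpha> \<epsilon> x
    using sm[OF that(1)] that(2) multi_deriv_diff[OF \<Omega>, of "u \<epsilon>" "v \<epsilon>" x "\<alpha> @ [i]"]
    by (subst multi_deriv_diff[OF \<Omega>]) (auto simp: smooth_on_partial_deriv multi_deriv_snoc)
  have "(\<lambda>\<epsilon> x. partial_deriv i (u \<epsilon>) x - partial_deriv i (v \<epsilon>) x) \<in> negligible_fun_nets \<Omega>"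
    unfolding negligible_fun_nets_iff
  proof (intro conjI ballI allI impI)
    show "smooth_on \<Omega> (\<lambda>x. partial_deriv i (u \<epsilon>) x - partial_deriv i (v \<epsilon>) x)"
      if "\<epsilon> \<in> {0<..1}" for \<epsilon>
      using sm[OF that] by (intro smooth_on_diff \<Omega> smooth_on_partial_deriv)
    fix K \<alpha> m assume K: "compact K \<and> K \<subseteq> \<Omega>"
    then obtain C where C: "C > 0" "\<forall>\<^sub>F \<epsilon> in at_right 0.
        \<forall>x\<in>K. \<bar>multi_deriv (\<alpha> @ [i]) (\<lambda>x. u \<epsilon> x - v \<epsilon> x) x\<bar> \<le> C * \<epsilon> ^ m"
      using negligible_fun_nets_bound[OF neg, of K "\<alpha> @ [i]" m] by blast
    from C(2) eventually_unit have "\<forall>\<^sub>F \<epsilon> in at_right 0.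
        \<forall>x\<in>K. \<bar>multi_deriv \<alpha> (\<lambda>x. partial_deriv i (u \<epsilon>) x - partial_deriv i (v \<epsilon>) x) x\<bar> \<le> C * \<epsilon> ^ m"
      by eventually_elim (use K in \<open>auto simp: eq\<close>)
    with C(1) show "\<exists>C>0. \<forall>\<^sub>F \<epsilon> in at_right 0.
        \<forall>x\<in>K. \<bar>multi_deriv \<alpha> (\<lambda>x. partial_deriv i (u \<epsilon>) x - partial_deriv i (v \<epsilon>) x) x\<bar> \<le> C * \<epsilon> ^ m"
      by blast
  qed
  then show ?thesis
    using mod by (simp add: fun_net_rel_def moderate_fun_nets_partial_deriv)
qed

lemma gen_partial_class:
  fixes u :: "real \<Rightarrow> real^'n \<Rightarrow> real"
  assumes \<Omega>: "open \<Omega>" and u: "u \<in> moderate_fun_nets \<Omega>"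
  shows "gen_partial \<Omega> i (fun_net_rel \<Omega> `` {u}) = fun_net_rel \<Omega> `` {\<lambda>\<epsilon>. partial_deriv i (u \<epsilon>)}"
proof -
  have "fun_net_rel \<Omega> `` {\<lambda>\<epsilon>. partial_deriv i (v \<epsilon>)} = fun_net_rel \<Omega> `` {\<lambda>\<epsilon>. partial_deriv i (u \<epsilon>)}"
    if "v \<in> fun_net_rel \<Omega> `` {u}" for v
    using that equiv_class_eq[OF equiv_fun_net_rel[OF \<Omega>] fun_net_rel_partial_deriv[OF \<Omega>]] by blast
  moreover have "u \<in> fun_net_rel \<Omega> `` {u}"
    using equiv_class_self[OF equiv_fun_net_rel[OF \<Omega>] u] .
  ultimately show ?thesis
    unfolding gen_partial_def by blast
qed


subsection \<open>Point values\<close>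

lemma compact_thickening:
  fixes K :: "(real^'n) set"
  assumes "compact K" "K \<subseteq> \<Omega>" "open \<Omega>"
  obtains \<delta> L where "0 < \<delta>" "compact L" "L \<subseteq> \<Omega>" "\<And>x. x \<in> K \<Longrightarrow> cball x \<delta> \<subseteq> L"
proof -
  obtain \<delta> where \<delta>: "\<delta> > 0" "(\<Union>x\<in>K. cball x \<delta>) \<subseteq> \<Omega>"
    using compact_subset_open_imp_cball_epsilon_subset[OF assms(1,3,2)] by blast
  let ?L = "{x + y |x y. x \<in> K \<and> y \<in> cball 0 \<delta>}"
  have "?L \<subseteq> (\<Union>x\<in>K. cball x \<delta>)"
    by (auto simp: dist_norm)
  moreover have "cball x \<delta> \<subseteq> ?L" if "x \<in> K" for x
  proof
    fix z assume "z \<in> cball x \<delta>"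
    then have "z = x + (z - x)" "z - x \<in> cball 0 \<delta>" by (auto simp: dist_norm norm_minus_commute)
    with that show "z \<in> ?L" by blast
  qed
  moreover have "compact ?L" using assms(1) by (intro compact_sums compact_cball)
  ultimately show thesis using \<delta> that[of \<delta> ?L] by blast
qed

lemma moderate_net_point:
  assumes u: "u \<in> moderate_fun_nets \<Omega>" and x: "x \<in> compact_point_nets \<Omega>'" and sub: "\<Omega>' \<subseteq> \<Omega>"
  shows "moderate_net (\<lambda>\<epsilon>. u \<epsilon> (x \<epsilon>))"
proof -
  obtain K where K: "compact K" "K \<subseteq> \<Omega>'" "\<forall>\<^sub>F \<epsilon> in at_right 0. x \<epsilon> \<in> K"
    using x by (auto simp: compact_point_nets_def)
  obtain N C where C: "C > 0" "\<forall>\<^sub>F \<epsilon> in at_right 0. \<forall>x\<in>K. \<bar>multi_deriv [] (u \<epsilon>) x\<bar> \<le> C / \<epsilon> ^ N"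
    using moderate_fun_nets_bound[OF u K(1), of "[]"] K(2) sub by blast
  from C(2) K(3) have "\<forall>\<^sub>F \<epsilon> in at_right 0. \<bar>u \<epsilon> (x \<epsilon>)\<bar> \<le> C / \<epsilon> ^ N"
    by eventually_elim simp
  with C(1) show ?thesis unfolding moderate_net_iff by blast
qed

text \<open>
  Once two equivalent points are closer than the distance of their compact carrier to the
  complement of \<open>\<Omega>\<close>, the segment between them stays in a compact set, on which the mean value
  theorem trades a moderate gradient against a negligible distance.
\<close>

lemma negligible_net_point_change:
  fixes u :: "real \<Rightarrow> real^'n \<Rightarrow> real"
  assumes \<Omega>: "open \<Omega>" and u: "u \<in> moderate_fun_nets \<Omega>"
    and xy: "(x, y) \<in> point_net_rel \<Omega>'" and sub: "\<Omega>' \<subseteq> \<Omega>"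
  shows "negligible_net (\<lambda>\<epsilon>. u \<epsilon> (x \<epsilon>) - u \<epsilon> (y \<epsilon>))"
  unfolding negligible_net_iff
proof
  fix m
  have y: "y \<in> compact_point_nets \<Omega>'" and neg: "negligible_net (\<lambda>\<epsilon>. norm (x \<epsilon> - y \<epsilon>))"
    using xy by (auto simp: point_net_rel_def)
  obtain K where K: "compact K" "K \<subseteq> \<Omega>'" "\<forall>\<^sub>F \<epsilon> in at_right 0. y \<epsilon> \<in> K"
    using y by (auto simp: compact_point_nets_def)
  then have "K \<subseteq> \<Omega>" using sub by blast
  then obtain \<delta> L where L: "0 < \<delta>" "compact L" "L \<subseteq> \<Omega>" "\<And>x. x \<in> K \<Longrightarrow> cball x \<delta> \<subseteq> L"
    using compact_thickening[OF K(1) _ \<Omega>] by metis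
  obtain N B where B: "B > 0" "\<forall>\<^sub>F \<epsilon> in at_right 0.
      \<forall>\<alpha>. length \<alpha> = 1 \<longrightarrow> (\<forall>x\<in>L. \<bar>multi_deriv \<alpha> (u \<epsilon>) x\<bar> \<le> B / \<epsilon> ^ N)"
    using moderate_fun_nets_bound_order[OF u L(2,3), of 1] by blast
  obtain C1 where C1: "C1 > 0" "\<forall>\<^sub>F \<epsilon> in at_right 0. norm (x \<epsilon> - y \<epsilon>) \<le> C1 * \<epsilon> ^ 1"
    using neg[unfolded negligible_net_iff, rule_format, of 1] by auto
  obtain C where C: "C > 0" "\<forall>\<^sub>F \<epsilon> in at_right 0. norm (x \<epsilon> - y \<epsilon>) \<le> C * \<epsilon> ^ (m + N)"
    using neg[unfolded negligible_net_iff, rule_format, of "m + N"] by auto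
  have "\<forall>\<^sub>F \<epsilon> in at_right 0. \<epsilon> \<in> {0<..<\<delta> / C1}"
    using L(1) C1(1) by (intro eventually_at_right_real) auto
  with eventually_unit K(3) B(2) C1(2) C(2)
  have "\<forall>\<^sub>F \<epsilon> in at_right 0. \<bar>u \<epsilon> (x \<epsilon>) - u \<epsilon> (y \<epsilon>)\<bar> \<le> (CARD('n) * B * C) * \<epsilon> ^ m"
  proof eventually_elim
    case (elim \<epsilon>)
    let ?v = "x \<epsilon> - y \<epsilon>"
    have "norm ?v \<le> \<delta>"
      using elim(4,6) C1(1) by (simp add: field_simps)
    then have seg: "y \<epsilon> + t *\<^sub>R ?v \<in> L" if "0 \<le> t" "t \<le> 1" for t
      using L(4)[OF elim(2)] that mult_left_le_one_le[of "norm ?v" t]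
      by (intro subsetD[OF L(4)[OF elim(2)]]) (auto simp: dist_norm)
    have "\<bar>u \<epsilon> (y \<epsilon> + ?v) - (\<Sum>k<1. (dir_deriv ?v ^^ k) (u \<epsilon>) (y \<epsilon>) / fact k)\<bar>
        \<le> (\<Sum>i\<in>UNIV. \<bar>?v $ i\<bar>) ^ 1 * (B / \<epsilon> ^ N)"
      using elim(3) by (intro taylor_segment[OF \<Omega> moderate_fun_nets_smooth[OF u elim(1)] _ seg L(3)]) auto
    then have "\<bar>u \<epsilon> (x \<epsilon>) - u \<epsilon> (y \<epsilon>)\<bar> \<le> (\<Sum>i\<in>UNIV. \<bar>?v $ i\<bar>) * (B / \<epsilon> ^ N)"
      by simp
    also have "\<dots> \<le> (CARD('n) * norm ?v) * (B / \<epsilon> ^ N)"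
      using B(1) elim(1) sum_bounded_above[of UNIV "\<lambda>i. \<bar>?v $ i\<bar>" "norm ?v", OF component_le_norm_cart]
      by (intro mult_right_mono) auto
    also have "\<dots> \<le> (CARD('n) * (C * \<epsilon> ^ (m + N))) * (B / \<epsilon> ^ N)"
      using B(1) elim(1,5) by (intro mult_right_mono mult_left_mono) auto
    also have "\<dots> = (CARD('n) * B * C) * \<epsilon> ^ m"
      using elim(1) by (simp add: power_add field_simps)
    finally show ?case .
  qed
  moreover have "CARD('n) * B * C > 0"
    using B(1) C(1) by simp
  ultimately show "\<exists>C>0. \<forall>\<^sub>F \<epsilon> in at_right 0. \<bar>u \<epsilon> (x \<epsilon>) - u \<epsilon> (y \<epsilon>)\<bar> \<le> C * \<epsilon> ^ m"
    by blast
qed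

lemma negligible_net_fun_change:
  assumes uv: "(u, v) \<in> fun_net_rel \<Omega>" and x: "x \<in> compact_point_nets \<Omega>'" and sub: "\<Omega>' \<subseteq> \<Omega>"
  shows "negligible_net (\<lambda>\<epsilon>. u \<epsilon> (x \<epsilon>) - v \<epsilon> (x \<epsilon>))"
  unfolding negligible_net_iff
proof
  fix m
  obtain K where K: "compact K" "K \<subseteq> \<Omega>'" "\<forall>\<^sub>F \<epsilon> in at_right 0. x \<epsilon> \<in> K"
    using x by (auto simp: compact_point_nets_def)
  obtain C where C: "C > 0"
    "\<forall>\<^sub>F \<epsilon> in at_right 0. \<forall>x\<in>K. \<bar>multi_deriv [] (\<lambda>x. u \<epsilon> x - v \<epsilon> x) x\<bar> \<le> C * \<epsilon> ^ m"
    using negligible_fun_nets_bound[of "\<lambda>\<epsilon> x. u \<epsilon> x - v \<epsilon> x" \<Omega> K "[]" m] uv K(1,2) sub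
    by (auto simp: fun_net_rel_def)
  from C(2) K(3) have "\<forall>\<^sub>F \<epsilon> in at_right 0. \<bar>u \<epsilon> (x \<epsilon>) - v \<epsilon> (x \<epsilon>)\<bar> \<le> C * \<epsilon> ^ m"
    by eventually_elim simp
  with C(1) show "\<exists>C>0. \<forall>\<^sub>F \<epsilon> in at_right 0. \<bar>u \<epsilon> (x \<epsilon>) - v \<epsilon> (x \<epsilon>)\<bar> \<le> C * \<epsilon> ^ m"
    by blast
qed

text \<open>
  A point value is a definite description over all representatives. It is evaluated by changing
  the point first and the function second; the two changes are negligible by the preceding lemmas.
\<close>

lemma point_value_class:
  fixes u :: "real \<Rightarrow> real^'n \<Rightarrow> real"
  assumes \<Omega>: "open \<Omega>" and u: "u \<in> moderate_fun_nets \<Omega>"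
    and x: "x \<in> compact_point_nets \<Omega>'" and sub: "\<Omega>' \<subseteq> \<Omega>"
  shows "point_value (fun_net_rel \<Omega> `` {u}) (point_net_rel \<Omega>' `` {x}) = abs_gen_real (\<lambda>\<epsilon>. u \<epsilon> (x \<epsilon>))"
proof -
  have eq: "abs_gen_real (\<lambda>\<epsilon>. u \<epsilon> (x \<epsilon>)) = abs_gen_real (\<lambda>\<epsilon>. v \<epsilon> (y \<epsilon>))"
    if uv: "(u, v) \<in> fun_net_rel \<Omega>" and xy: "(x, y) \<in> point_net_rel \<Omega>'" for v y
  proof -
    have v: "v \<in> moderate_fun_nets \<Omega>" and y: "y \<in> compact_point_nets \<Omega>'"
      using uv xy by (auto simp: fun_net_rel_def point_net_rel_def)
    have "negligible_net (\<lambda>\<epsilon>. (u \<epsilon> (x \<epsilon>) - u \<epsilon> (y \<epsilon>)) + (u \<epsilon> (y \<epsilon>) - v \<epsilon> (y \<epsilon>)))"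
      by (intro negligible_net_add negligible_net_point_change[OF \<Omega> u xy sub]
          negligible_net_fun_change[OF uv y sub])
    then show ?thesis
      using moderate_net_point[OF u x sub] moderate_net_point[OF v y sub]
      by (simp add: abs_gen_real_eq_iff)
  qed
  have uu: "u \<in> fun_net_rel \<Omega> `` {u}"
    using equiv_class_self[OF equiv_fun_net_rel[OF \<Omega>] u] .
  have xx: "x \<in> point_net_rel \<Omega>' `` {x}"
    using x by (simp add: point_net_rel_def negligible_net_0)
  show ?thesis
    unfolding point_value_def
  proof (rule the_equality)
    show "\<forall>v\<in>fun_net_rel \<Omega> `` {u}. \<forall>y\<in>point_net_rel \<Omega>' `` {x}.
        abs_gen_real (\<lambda>\<epsilon>. u \<epsilon> (x \<epsilon>)) = abs_gen_real (\<lambda>\<epsilon>. v \<epsilon> (y \<epsilon>))"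
      by (intro ballI eq) (simp_all only: Image_singleton_iff)
  qed (drule bspec[OF _ uu], erule bspec[OF _ xx])
qed

section \<open>Local minima of generalized functions\<close>

lemma const_compact_point_net: "x \<in> \<Omega> \<Longrightarrow> (\<lambda>_. x) \<in> compact_point_nets \<Omega>"
  by (auto simp: compact_point_nets_def intro!: exI[of _ "{x}"])

text \<open>
  Displacements that leave the ball, possible only for large \<open>\<epsilon>\<close>, are replaced by \<open>0\<close>; this yields a
  compactly supported generalized point of the neighbourhood on which the minimality is assumed.
\<close>

lemma local_min_net_bound:
  fixes u :: "real \<Rightarrow> real^'n \<Rightarrow> real"
  assumes \<Omega>: "open \<Omega>" and u: "u \<in> moderate_fun_nets \<Omega>"
    and min: "is_local_min \<Omega> (fun_net_rel \<Omega> `` {u}) x0"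
  obtains r where "0 < r" "cball x0 r \<subseteq> \<Omega>"
    "\<And>v m. \<forall>\<^sub>F \<epsilon> in at_right 0. norm (v \<epsilon>) \<le> r \<Longrightarrow>
       \<exists>C>0. \<forall>\<^sub>F \<epsilon> in at_right 0. - (C * \<epsilon> ^ m) \<le> u \<epsilon> (x0 + v \<epsilon>) - u \<epsilon> x0"
proof -
  let ?f = "fun_net_rel \<Omega> `` {u}"
  obtain \<Omega>' where \<Omega>': "open \<Omega>'" "x0 \<in> \<Omega>'" "\<Omega>' \<subseteq> \<Omega>" and x0: "x0 \<in> \<Omega>"
    and le: "\<And>X. X \<in> gen_points_c \<Omega>' \<Longrightarrow> point_value ?f (const_point \<Omega> x0) \<le> point_value ?f X"
    using min unfolding is_local_min_def by blast
  obtain r where r: "0 < r" "cball x0 r \<subseteq> \<Omega>'"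
    using \<Omega>' open_contains_cball by blast
  have "\<exists>C>0. \<forall>\<^sub>F \<epsilon> in at_right 0. - (C * \<epsilon> ^ m) \<le> u \<epsilon> (x0 + v \<epsilon>) - u \<epsilon> x0"
    if v: "\<forall>\<^sub>F \<epsilon> in at_right 0. norm (v \<epsilon>) \<le> r" for v m
  proof -
    define x where "x \<epsilon> = (if norm (v \<epsilon>) \<le> r then x0 + v \<epsilon> else x0)" for \<epsilon>
    have "x \<epsilon> \<in> cball x0 r" for \<epsilon>
      using r(1) by (simp add: x_def dist_norm)
    then have x: "x \<in> compact_point_nets \<Omega>'"
      using r(2) unfolding compact_point_nets_def
      by (auto intro!: exI[of _ "cball x0 r"])
    note c = const_compact_point_net[OF x0]
    have "abs_gen_real (\<lambda>\<epsilon>. u \<epsilon> x0) \<le> abs_gen_real (\<lambda>\<epsilon>. u \<epsilon> (x \<epsilon>))"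
      using le[of "point_net_rel \<Omega>' `` {x}"] x
        point_value_class[OF \<Omega> u c order.refl] point_value_class[OF \<Omega> u x \<Omega>'(3)]
      by (simp add: const_point_def gen_points_c_def quotientI)
    then have "0 \<le> abs_gen_real (\<lambda>\<epsilon>. u \<epsilon> (x \<epsilon>) - u \<epsilon> x0)"
      using abs_gen_real_diff[OF moderate_net_point[OF u x \<Omega>'(3)] moderate_net_point[OF u c order.refl]]
      by (metis diff_ge_0_iff_ge)
    moreover have "moderate_net (\<lambda>\<epsilon>. u \<epsilon> (x \<epsilon>) - u \<epsilon> x0)"
      using moderate_net_add[OF moderate_net_point[OF u x \<Omega>'(3)]
          moderate_net_uminus[OF moderate_net_point[OF u c order.refl]]] by simp
    ultimately obtain C where C: "C > 0" "\<forall>\<^sub>F \<epsilon> in at_right 0. - (C * \<epsilon> ^ m) \<le> u \<epsilon> (x \<epsilon>) - u \<epsilon> x0"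
      using zero_le_abs_gen_real_iff by blast
    from C(2) v have "\<forall>\<^sub>F \<epsilon> in at_right 0. - (C * \<epsilon> ^ m) \<le> u \<epsilon> (x0 + v \<epsilon>) - u \<epsilon> x0"
      by eventually_elim (simp add: x_def)
    with C(1) show ?thesis by blast
  qed
  with r \<Omega>'(3) show thesis
    by (intro that[of r]) auto
qed

lemma cball_segment:
  fixes v :: "real^'n"
  assumes "norm v \<le> r" "0 \<le> t" "t \<le> 1"
  shows "x + t *\<^sub>R v \<in> cball x r"
  using assms mult_left_le_one_le[of "norm v" t] by (simp add: dist_norm)

lemma dir_deriv_scaleR_axis: "dir_deriv (a *\<^sub>R axis i 1) g y = a * partial_deriv i g y"
  by (simp add: dir_deriv_def axis_def if_distrib[of "\<lambda>z. a * z"] if_distrib[of "\<lambda>z. z * _"] cong: if_cong)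

text \<open>
  Stepping by \<open>s = r \<epsilon> ^ (m + N)\<close> against the sign of the partial derivative \<open>d\<close> changes the value by
  \<open>-s \<bar>d\<bar>\<close> up to a remainder \<open>s\<^sup>2 B / \<epsilon> ^ N\<close>. Minimality forbids a decrease beyond
  \<open>C \<epsilon> ^ (m + (m + N))\<close>, and dividing by \<open>s\<close> leaves a multiple of \<open>\<epsilon> ^ m\<close>.
\<close>

lemma local_min_partial_negligible:
  fixes u :: "real \<Rightarrow> real^'n \<Rightarrow> real"
  assumes \<Omega>: "open \<Omega>" and u: "u \<in> moderate_fun_nets \<Omega>" and r: "0 < r" "cball x0 r \<subseteq> \<Omega>"
    and min: "\<And>v m. \<forall>\<^sub>F \<epsilon> in at_right 0. norm (v \<epsilon>) \<le> r \<Longrightarrow>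
       \<exists>C>0. \<forall>\<^sub>F \<epsilon> in at_right 0. - (C * \<epsilon> ^ m) \<le> u \<epsilon> (x0 + v \<epsilon>) - u \<epsilon> x0"
  shows "negligible_net (\<lambda>\<epsilon>. partial_deriv i (u \<epsilon>) x0)"
  unfolding negligible_net_iff
proof
  fix m
  obtain N B where B: "B > 0" "\<forall>\<^sub>F \<epsilon> in at_right 0.
      \<forall>\<alpha>. length \<alpha> = 2 \<longrightarrow> (\<forall>x\<in>cball x0 r. \<bar>multi_deriv \<alpha> (u \<epsilon>) x\<bar> \<le> B / \<epsilon> ^ N)"
    using moderate_fun_nets_bound_order[OF u compact_cball r(2), of 2] by blast
  define d where "d \<epsilon> = partial_deriv i (u \<epsilon>) x0" for \<epsilon>
  define s where "s \<epsilon> = r * \<epsilon> ^ (m + N)" for \<epsilon>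
  define v :: "real \<Rightarrow> real^'n" where "v \<epsilon> = (- s \<epsilon> * sgn (d \<epsilon>)) *\<^sub>R axis i 1" for \<epsilon>
  have s: "0 < s \<epsilon>" "s \<epsilon> \<le> r" if "\<epsilon> \<in> {0<..1}" for \<epsilon>
    using that r(1) by (auto simp: s_def mult_le_cancel_left1 power_le_one)
  have v_norm: "norm (v \<epsilon>) \<le> r" if "\<epsilon> \<in> {0<..1}" for \<epsilon>
    using s[OF that] r(1) by (auto simp: v_def norm_axis_1 abs_mult sgn_if)
  then have "\<forall>\<^sub>F \<epsilon> in at_right 0. norm (v \<epsilon>) \<le> r"
    by (rule eventually_mono[OF eventually_unit])
  from min[OF this, of "m + (m + N)"] obtain C where C: "C > 0"
    "\<forall>\<^sub>F \<epsilon> in at_right 0. - (C * \<epsilon> ^ (m + (m + N))) \<le> u \<epsilon> (x0 + v \<epsilon>) - u \<epsilon> x0"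
    by blast
  from eventually_unit B(2) C(2) have "\<forall>\<^sub>F \<epsilon> in at_right 0. \<bar>d \<epsilon>\<bar> \<le> (r * B + C / r) * \<epsilon> ^ m"
  proof eventually_elim
    case (elim \<epsilon>)
    have D: "dir_deriv (v \<epsilon>) (u \<epsilon>) x0 = - (s \<epsilon> * \<bar>d \<epsilon>\<bar>)"
      unfolding v_def dir_deriv_scaleR_axis by (simp add: d_def[symmetric] abs_sgn mult_ac)
    have "(\<Sum>j\<in>UNIV. \<bar>v \<epsilon> $ j\<bar>) = \<bar>s \<epsilon> * sgn (d \<epsilon>)\<bar>"
      unfolding v_def by (simp add: axis_def abs_mult if_distrib[of "\<lambda>z. _ * z"] if_distrib[of abs] cong: if_cong)
    also have "\<dots> \<le> s \<epsilon>"
      using s[OF elim(1)] by (simp add: abs_mult sgn_if)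
    finally have L: "(\<Sum>j\<in>UNIV. \<bar>v \<epsilon> $ j\<bar>) \<le> s \<epsilon>" .
    have "\<bar>u \<epsilon> (x0 + v \<epsilon>) - (\<Sum>k<2. (dir_deriv (v \<epsilon>) ^^ k) (u \<epsilon>) x0 / fact k)\<bar>
        \<le> (\<Sum>j\<in>UNIV. \<bar>v \<epsilon> $ j\<bar>) ^ 2 * (B / \<epsilon> ^ N)"
      using elim(2) r(2) v_norm[OF elim(1)]
      by (intro taylor_segment[OF \<Omega> moderate_fun_nets_smooth[OF u elim(1)], where K = "cball x0 r"] cball_segment) auto
    also have "\<dots> \<le> (s \<epsilon>)\<^sup>2 * (B / \<epsilon> ^ N)"
      using B(1) elim(1) by (intro mult_right_mono power_mono L sum_nonneg) auto
    finally have "\<bar>u \<epsilon> (x0 + v \<epsilon>) - (u \<epsilon> x0 - s \<epsilon> * \<bar>d \<epsilon>\<bar>)\<bar> \<le> (s \<epsilon>)\<^sup>2 * (B / \<epsilon> ^ N)"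
      by (simp add: eval_nat_numeral D)
    with elim(3) have "s \<epsilon> * \<bar>d \<epsilon>\<bar> \<le> (s \<epsilon>)\<^sup>2 * (B / \<epsilon> ^ N) + C * \<epsilon> ^ (m + (m + N))"
      by linarith
    also have "(s \<epsilon>)\<^sup>2 * (B / \<epsilon> ^ N) = s \<epsilon> * (r * B * \<epsilon> ^ m)"
      using elim(1) by (simp add: s_def power2_eq_square power_add)
    also have "C * \<epsilon> ^ (m + (m + N)) = s \<epsilon> * (C / r * \<epsilon> ^ m)"
      using r(1) by (simp add: s_def power_add)
    finally have "s \<epsilon> * \<bar>d \<epsilon>\<bar> \<le> s \<epsilon> * ((r * B + C / r) * \<epsilon> ^ m)"
      by (simp add: algebra_simps)
    then show ?case
      using s(1)[OF elim(1)] by (simp only: mult_le_cancel_left_pos)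
  qed
  moreover have "r * B + C / r > 0"
    using r(1) B(1) C(1) by (intro add_pos_pos) auto
  ultimately show "\<exists>C>0. \<forall>\<^sub>F \<epsilon> in at_right 0. \<bar>partial_deriv i (u \<epsilon>) x0\<bar> \<le> C * \<epsilon> ^ m"
    unfolding d_def by blast
qed

text \<open>
  The displacement is \<open>\<epsilon> ^ k * z\<close>. In units of \<open>\<epsilon> ^ (m + 2 * k)\<close>, the minimality defect, the gradient
  term and the third-order remainder all have bounded size; the quadratic term is
  \<open>\<epsilon> ^ (2 * k) / 2\<close> times the quadratic form.
\<close>

lemma local_min_hessian_bound:
  fixes u :: "real \<Rightarrow> real^'n \<Rightarrow> real" and z :: "'n \<Rightarrow> real \<Rightarrow> real"
  assumes \<Omega>: "open \<Omega>" and u: "u \<in> moderate_fun_nets \<Omega>" and r: "0 < r" "cball x0 r \<subseteq> \<Omega>"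
    and min: "\<And>v m. \<forall>\<^sub>F \<epsilon> in at_right 0. norm (v \<epsilon>) \<le> r \<Longrightarrow>
       \<exists>C>0. \<forall>\<^sub>F \<epsilon> in at_right 0. - (C * \<epsilon> ^ m) \<le> u \<epsilon> (x0 + v \<epsilon>) - u \<epsilon> x0"
    and z: "\<And>i. moderate_net (z i)"
  shows "\<exists>C>0. \<forall>\<^sub>F \<epsilon> in at_right 0. - (C * \<epsilon> ^ m) \<le>
    (\<Sum>i\<in>UNIV. \<Sum>j\<in>UNIV. z i \<epsilon> * z j \<epsilon> * partial_deriv i (partial_deriv j (u \<epsilon>)) x0)"
proof -
  define w :: "real \<Rightarrow> real^'n" where "w \<epsilon> = (\<chi> i. z i \<epsilon>)" for \<epsilon>
  obtain N B where B: "B > 0" "\<forall>\<^sub>F \<epsilon> in at_right 0.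
      \<forall>\<alpha>. length \<alpha> = 3 \<longrightarrow> (\<forall>x\<in>cball x0 r. \<bar>multi_deriv \<alpha> (u \<epsilon>) x\<bar> \<le> B / \<epsilon> ^ N)"
    using moderate_fun_nets_bound_order[OF u compact_cball r(2), of 3] by blast
  have "moderate_net (\<lambda>\<epsilon>. \<Sum>i\<in>UNIV. \<bar>w \<epsilon> $ i\<bar>)"
    unfolding w_def using z by (intro moderate_net_sum) (simp_all add: moderate_net_abs)
  then obtain M A where A: "A > 0" "\<forall>\<^sub>F \<epsilon> in at_right 0. (\<Sum>i\<in>UNIV. \<bar>w \<epsilon> $ i\<bar>) \<le> A / \<epsilon> ^ M"
    unfolding moderate_net_iff by (auto simp: sum_nonneg)
  \<comment> \<open>The remainder \<open>\<epsilon> ^ (3 * k - 3 * M - N)\<close> must not exceed \<open>\<epsilon> ^ (m + 2 * k)\<close>, and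
    \<open>\<epsilon> ^ (k - M)\<close>, which bounds the displacement, must tend to \<open>0\<close>.\<close>
  define k where "k = m + 3 * M + N + 1"
  have w_small: "\<forall>\<^sub>F \<epsilon> in at_right 0. norm (\<epsilon> ^ k *\<^sub>R w \<epsilon>) \<le> r"
  proof -
    have "\<forall>\<^sub>F \<epsilon> in at_right 0. \<epsilon> \<in> {0<..<r / A}"
      using r(1) A(1) by (intro eventually_at_right_real) auto
    with eventually_unit A(2) show ?thesis
    proof eventually_elim
      case (elim \<epsilon>)
      have "norm (\<epsilon> ^ k *\<^sub>R w \<epsilon>) = \<epsilon> ^ k * norm (w \<epsilon>)"
        using elim(1) by simp
      also have "\<dots> \<le> \<epsilon> ^ (M + 1) * (A / \<epsilon> ^ M)"
        using elim(1,2) norm_le_l1_cart[of "w \<epsilon>"]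
        by (intro mult_mono power_decreasing) (auto simp: k_def)
      also have "\<dots> = A * \<epsilon>"
        using elim(1) by simp
      also have "\<dots> \<le> r"
        using elim(3) A(1) by (simp add: field_simps)
      finally show ?case .
    qed
  qed
  from min[OF this, of "m + 2 * k"] obtain C1 where C1: "C1 > 0"
    "\<forall>\<^sub>F \<epsilon> in at_right 0. - (C1 * \<epsilon> ^ (m + 2 * k)) \<le> u \<epsilon> (x0 + \<epsilon> ^ k *\<^sub>R w \<epsilon>) - u \<epsilon> x0"
    by blast
  have "negligible_net (\<lambda>\<epsilon>. dir_deriv (w \<epsilon>) (u \<epsilon>) x0)"
    unfolding dir_deriv_def w_def
    using negligible_net_mult[OF local_min_partial_negligible[OF \<Omega> u r min] z]
    by (intro negligible_net_sum) (simp_all add: mult.commute)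
  then obtain C2 where C2: "C2 > 0"
    "\<forall>\<^sub>F \<epsilon> in at_right 0. \<bar>dir_deriv (w \<epsilon>) (u \<epsilon>) x0\<bar> \<le> C2 * \<epsilon> ^ (m + k)"
    unfolding negligible_net_iff by blast
  define q where
    "q \<epsilon> = (\<Sum>i\<in>UNIV. \<Sum>j\<in>UNIV. z i \<epsilon> * z j \<epsilon> * partial_deriv i (partial_deriv j (u \<epsilon>)) x0)" for \<epsilon>
  let ?C = "2 * (C1 + C2 + A ^ 3 * B)"
  from eventually_unit B(2) A(2) w_small C1(2) C2(2)
  have "\<forall>\<^sub>F \<epsilon> in at_right 0. - (?C * \<epsilon> ^ m) \<le> q \<epsilon>"
  proof eventually_elim
    case (elim \<epsilon>)
    let ?v = "\<epsilon> ^ k *\<^sub>R w \<epsilon>" and ?L = "\<Sum>i\<in>UNIV. \<bar>w \<epsilon> $ i\<bar>"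
    note sm = moderate_fun_nets_smooth[OF u elim(1)]
    have D1: "dir_deriv ?v (u \<epsilon>) x0 = \<epsilon> ^ k * dir_deriv (w \<epsilon>) (u \<epsilon>) x0"
      by (simp add: dir_deriv_def sum_distrib_left mult_ac)
    have D2: "dir_deriv ?v (dir_deriv ?v (u \<epsilon>)) x0 = (\<epsilon> ^ k)\<^sup>2 * q \<epsilon>"
      using r by (subst dir_deriv_twice[OF \<Omega> sm])
        (auto simp: q_def w_def sum_distrib_left power2_eq_square mult_ac)
    have "(\<Sum>i\<in>UNIV. \<bar>?v $ i\<bar>) = \<epsilon> ^ k * ?L"
      using elim(1) by (simp add: abs_mult sum_distrib_left)
    then have L: "(\<Sum>i\<in>UNIV. \<bar>?v $ i\<bar>) \<le> \<epsilon> ^ k * (A / \<epsilon> ^ M)"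
      using elim(1,3) by (simp only:) (intro mult_left_mono, auto)
    have "\<bar>u \<epsilon> (x0 + ?v) - (\<Sum>n<3. (dir_deriv ?v ^^ n) (u \<epsilon>) x0 / fact n)\<bar>
        \<le> (\<Sum>i\<in>UNIV. \<bar>?v $ i\<bar>) ^ 3 * (B / \<epsilon> ^ N)"
      using elim(2) r(2) elim(4)
      by (intro taylor_segment[OF \<Omega> sm, where K = "cball x0 r"] cball_segment) auto
    moreover have "(\<Sum>n<3. (dir_deriv ?v ^^ n) (u \<epsilon>) x0 / fact n)
        = u \<epsilon> x0 + \<epsilon> ^ k * dir_deriv (w \<epsilon>) (u \<epsilon>) x0 + (\<epsilon> ^ k)\<^sup>2 * q \<epsilon> / 2"
      by (simp add: numeral_3_eq_3 D1 D2)
    ultimately have "\<bar>u \<epsilon> (x0 + ?v) - (u \<epsilon> x0 + \<epsilon> ^ k * dir_deriv (w \<epsilon>) (u \<epsilon>) x0 + (\<epsilon> ^ k)\<^sup>2 * q \<epsilon> / 2)\<bar>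
        \<le> (\<Sum>i\<in>UNIV. \<bar>?v $ i\<bar>) ^ 3 * (B / \<epsilon> ^ N)"
      by simp
    also have "\<dots> \<le> (\<epsilon> ^ k * (A / \<epsilon> ^ M)) ^ 3 * (B / \<epsilon> ^ N)"
      using B(1) elim(1) by (intro mult_right_mono power_mono L sum_nonneg) auto
    also have "\<dots> = A ^ 3 * B * (\<epsilon> ^ (3 * k) / \<epsilon> ^ (3 * M + N))"
      by (simp add: power_mult_distrib power_divide power_add power_mult[symmetric] mult_ac)
    also have "\<dots> = A ^ 3 * B * \<epsilon> ^ (3 * k - (3 * M + N))"
      using elim(1) by (subst power_diff) (auto simp: k_def)
    also have "\<dots> \<le> A ^ 3 * B * \<epsilon> ^ (m + 2 * k)"
      using elim(1) A(1) B(1) by (intro mult_left_mono power_decreasing) (auto simp: k_def)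
    finally have T: "\<bar>u \<epsilon> (x0 + ?v) - (u \<epsilon> x0 + \<epsilon> ^ k * dir_deriv (w \<epsilon>) (u \<epsilon>) x0 + (\<epsilon> ^ k)\<^sup>2 * q \<epsilon> / 2)\<bar>
        \<le> A ^ 3 * B * \<epsilon> ^ (m + 2 * k)" .
    have pow: "\<epsilon> ^ (m + 2 * k) = \<epsilon> ^ m * (\<epsilon> ^ k)\<^sup>2"
      by (simp add: power_add power_mult[symmetric] mult.commute)
    have "\<epsilon> ^ k * dir_deriv (w \<epsilon>) (u \<epsilon>) x0 \<le> \<epsilon> ^ k * (C2 * \<epsilon> ^ (m + k))"
      using elim(1,6) by (intro mult_left_mono) auto
    also have "\<dots> = C2 * \<epsilon> ^ (m + 2 * k)"
      unfolding pow by (simp add: power_add power2_eq_square)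
    finally have "- (C1 * \<epsilon> ^ (m + 2 * k) + C2 * \<epsilon> ^ (m + 2 * k) + A ^ 3 * B * \<epsilon> ^ (m + 2 * k))
        \<le> (\<epsilon> ^ k)\<^sup>2 * q \<epsilon> / 2"
      using T elim(5) by linarith
    moreover have "C1 * \<epsilon> ^ (m + 2 * k) + C2 * \<epsilon> ^ (m + 2 * k) + A ^ 3 * B * \<epsilon> ^ (m + 2 * k)
        = (\<epsilon> ^ k)\<^sup>2 * (?C * \<epsilon> ^ m) / 2"
      unfolding pow by (simp add: field_simps)
    ultimately have "(\<epsilon> ^ k)\<^sup>2 * (- (?C * \<epsilon> ^ m)) \<le> (\<epsilon> ^ k)\<^sup>2 * q \<epsilon>"
      by linarith
    then show ?case
      using elim(1) by (subst (asm) mult_le_cancel_left_pos) auto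
  qed
  moreover have "?C > 0"
    using A(1) B(1) C1(1) C2(1) by (simp add: add_pos_pos)
  ultimately show ?thesis unfolding q_def by blast
qed

theorem proposition2p1:
  fixes \<Omega> :: "(real^'p) set" and f :: "'p gen_fun" and x0 :: "real^'p"
  assumes "open \<Omega>"
    and "f \<in> colombeau \<Omega>"
    and "x0 \<in> \<Omega>"
    and "is_local_min \<Omega> f x0"
  shows "gen_gradient \<Omega> f x0 = 0 \<and> pos_semidef (gen_hessian \<Omega> f x0)"
proof -
  note \<Omega> = assms(1) and c = const_compact_point_net[OF assms(3)]
  obtain u where u: "u \<in> moderate_fun_nets \<Omega>" and f: "f = fun_net_rel \<Omega> `` {u}"
    using assms(2) unfolding colombeau_def by (rule quotientE)
  obtain r where r: "0 < r" "cball x0 r \<subseteq> \<Omega>" and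
    min: "\<And>v m. \<forall>\<^sub>F \<epsilon> in at_right 0. norm (v \<epsilon>) \<le> r \<Longrightarrow>
       \<exists>C>0. \<forall>\<^sub>F \<epsilon> in at_right 0. - (C * \<epsilon> ^ m) \<le> u \<epsilon> (x0 + v \<epsilon>) - u \<epsilon> x0"
    using local_min_net_bound[OF \<Omega> u assms(4)[unfolded f]] by blast
  note u1 = moderate_fun_nets_partial_deriv[OF u]
  note u2 = moderate_fun_nets_partial_deriv[OF u1]
  define h where "h i j \<epsilon> = partial_deriv i (partial_deriv j (u \<epsilon>)) x0" for i j \<epsilon>
  have h: "moderate_net (h i j)" for i j
    unfolding h_def using moderate_net_point[OF u2 c order.refl] .
  have grad: "gen_gradient \<Omega> f x0 = 0"
  proof -
    have "abs_gen_real (\<lambda>\<epsilon>. partial_deriv i (u \<epsilon>) x0) = 0" for i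
      using local_min_partial_negligible[OF \<Omega> u r min, of i] moderate_net_point[OF u1 c order.refl]
      by (simp add: zero_gen_real_def abs_gen_real_eq_iff moderate_net_const)
    then show ?thesis
      by (simp add: vec_eq_iff gen_gradient_def f gen_partial_class[OF \<Omega> u] const_point_def
          point_value_class[OF \<Omega> u1 c order.refl])
  qed
  have H: "gen_hessian \<Omega> f x0 $ i $ j = abs_gen_real (h i j)" for i j
    by (simp add: gen_hessian_def f gen_partial_class[OF \<Omega> u] gen_partial_class[OF \<Omega> u1]
        const_point_def point_value_class[OF \<Omega> u2 c order.refl] h_def[abs_def])
  have "transpose (gen_hessian \<Omega> f x0) = gen_hessian \<Omega> f x0"
  proof -
    have "abs_gen_real (h i j) = abs_gen_real (h j i)" for i j
    proof -
      have "\<forall>\<^sub>F \<epsilon> in at_right 0. \<bar>h i j \<epsilon> - h j i \<epsilon>\<bar> \<le> 1 * \<epsilon> ^ m" for m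
        using eventually_unit
        by eventually_elim
          (simp add: h_def partial_deriv_commute[OF \<Omega> moderate_fun_nets_smooth[OF u] assms(3), of _ i j])
      then have "negligible_net (\<lambda>\<epsilon>. h i j \<epsilon> - h j i \<epsilon>)"
        unfolding negligible_net_iff using zero_less_one by blast
      then show ?thesis using h by (simp add: abs_gen_real_eq_iff)
    qed
    then show ?thesis by (simp add: vec_eq_iff transpose_def H)
  qed
  moreover have "0 \<le> (\<Sum>i\<in>UNIV. \<xi> $ i * (gen_hessian \<Omega> f x0 *v \<xi>) $ i)" for \<xi>
  proof -
    have "\<exists>z. moderate_net z \<and> \<xi> $ i = abs_gen_real z" for i
      by (rule gen_real_cases[of "\<xi> $ i"]) blast
    then obtain z where z: "\<And>i. moderate_net (z i)" "\<And>i. \<xi> $ i = abs_gen_real (z i)"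
      by metis
    let ?q = "\<lambda>\<epsilon>. \<Sum>i\<in>UNIV. \<Sum>j\<in>UNIV. z i \<epsilon> * z j \<epsilon> * h i j \<epsilon>"
    have q: "moderate_net ?q"
      using z(1) h by (intro moderate_net_sum moderate_net_mult) auto
    have "(\<Sum>i\<in>UNIV. \<xi> $ i * (gen_hessian \<Omega> f x0 *v \<xi>) $ i)
        = (\<Sum>i\<in>UNIV. \<Sum>j\<in>UNIV. abs_gen_real (z i) * abs_gen_real (z j) * abs_gen_real (h i j))"
      by (simp add: matrix_vector_mult_def H z(2) sum_distrib_left mult_ac)
    also have "\<dots> = abs_gen_real ?q"
      using z(1) h by (simp add: abs_gen_real_times abs_gen_real_sum moderate_net_mult moderate_net_sum)
    also have "0 \<le> \<dots>"
      unfolding zero_le_abs_gen_real_iff[OF q] unfolding h_def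
      by (intro allI local_min_hessian_bound[OF \<Omega> u r _ z(1)]) (rule min)
    finally show ?thesis .
  qed
  ultimately show ?thesis
    using grad by (simp add: pos_semidef_def)
qed

end
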